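(* For every $h \in \mathbb{N}$ there exists $\epsilon = \epsilon(h) > 0$ such that the following holds: there exists $n_0 = n_0(\epsilon, h)$ such that if $A \subseteq \mathbb{R}$ is a finite set of size $n \ge n_0$ and $|A.A| \le |A|^{1+\epsilon}$, then \[ |hA| \ge |A|^{c\, e^{\sqrt{\frac{1}{100}\log h}}}, \] where $c>0$ is an absolute constant.
   Context: For a finite set $A \subseteq \mathbb{R}$, $A.A := \{a a' : a, a' \in A\}$ and $hA := \{a_1 + \cdots + a_h : a_i \in A\}$ is the $h$-fold sumset. $\log$ denotes the natural logarithm. *)

theory Defs
  imports "HOL-Analysis.Analysis" "HOL-Library.Set_Algebras"
begin

(* The product set A.A is the elementwise product A * A of HOL-Library.Set_Algebras.
   In the sumset the summands need not be distinct; only f on {..<h} matters. *)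

definition hfold_sumset :: "nat \<Rightarrow> 'a::comm_monoid_add set \<Rightarrow> 'a set" where
  "hfold_sumset h A = {(\<Sum>i<h. f i) | f. \<forall>i<h. f i \<in> A}"

end

theory Submission
  imports Defs "HOL-Computational_Algebra.Polynomial"
begin

text \<open>
  Let \<open>A\<close> consist of positive numbers and have few products. A pigeonhole argument gives a ratio
  \<open>\<theta> = e\<^sup>d > 1\<close> such that \<open>A \<inter> \<theta>\<^sup>b A\<close> is large for all \<open>b \<le> B\<close>, while many elements of \<open>A\<close> are separated by
  ratios at least \<open>\<theta>\<close>. If these elements are spread over many dyadic scales, a lacunary subset
  already has many sums. Otherwise many of them lie in one interval \<open>[x, 2x]\<close>, and \<open>\<theta>\<close> is close to 1.

  Counting the moments of subsets of \<open>{..B}\<close> produces, for about \<open>B\<close> to the power 1/4 different orders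
  \<open>f\<close>, a sum \<open>u\<^sub>f\<close> of at most \<open>2(B + 1)\<close> terms \<open>\<plusminus>\<theta>\<^sup>b\<close> of size about \<open>d\<^sup>f\<close>. Since these \<open>u\<^sub>f\<close> live on separate
  scales, the sums \<open>\<Sum> u\<^sub>f a\<^sub>f\<close> with \<open>a\<^sub>f\<close> in the separated set are all distinct. They lie in a
  difference of two sums of dilates \<open>\<theta>\<^sup>b A\<close>.

  Such a sum of dilates is not much larger than a sumset of \<open>A\<close>: if \<open>A\<close> is first thinned out so that
  passing to large subsets does not shrink its sumsets, then \<open>j(A \<inter> \<theta>\<^sup>b A)\<close> absorbs a summand \<open>\<theta>\<^sup>b A\<close>
  almost for free by Petridis' inequality. All costs are polynomial in \<open>B\<close>, so the exponent obtained
  is a power of \<open>h\<close>, which exceeds \<open>exp (sqrt (ln h / 100))\<close> up to a constant.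
\<close>

section \<open>Sumsets and Petridis' inequality\<close>

text \<open>Read in the commutative monoid of sets under \<open>+\<close>, whose zero is
  \<open>{0}\<close>, sumsets can be regrouped by the ordinary laws of finite sums.\<close>

lemma hfold_sumset_eq_sum: "hfold_sumset h A = (\<Sum>i<h. A)"
  by (auto simp: hfold_sumset_def set_sum_alt)

lemma hfold_sumset_0 [simp]: "hfold_sumset 0 A = {0}"
  by (simp add: hfold_sumset_eq_sum)

lemma hfold_sumset_Suc: "hfold_sumset (Suc m) A = hfold_sumset m A + A"
  by (simp add: hfold_sumset_eq_sum add.commute)

lemma hfold_sumset_add: "hfold_sumset (m + k) A = hfold_sumset m A + hfold_sumset k A"
  by (induction k) (simp_all add: hfold_sumset_Suc add.assoc flip: set_zero)

lemma hfold_sumset_mono: "A \<subseteq> B \<Longrightarrow> hfold_sumset m A \<subseteq> hfold_sumset m B"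
  by (induction m) (simp_all add: hfold_sumset_Suc set_plus_mono2)

lemma finite_hfold_sumset [simp]: "finite A \<Longrightarrow> finite (hfold_sumset m A)"
  by (induction m) (simp_all add: hfold_sumset_Suc finite_set_plus)

lemma hfold_sumset_nonempty: "A \<noteq> {} \<Longrightarrow> hfold_sumset m A \<noteq> {}"
  by (induction m) (auto simp: hfold_sumset_Suc set_plus_def)

lemma hfold_sumset_image_mult:
  fixes A :: "'a::comm_semiring_0 set"
  shows "hfold_sumset m ((*) c ` A) = (*) c ` hfold_sumset m A"
proof (induction m)
  case (Suc m)
  show ?case
    unfolding hfold_sumset_Suc Suc set_plus_def
    by (force simp: distrib_left image_iff)
qed simp

lemma card_translate [simp]:
  fixes A :: "'a::ab_group_add set"
  shows "card ((+) c ` A) = card A"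
  by (simp add: card_image)

lemma card_set_plus_le_left:
  fixes A B :: "'a::ab_group_add set"
  assumes "finite A" "finite B" "B \<noteq> {}"
  shows "card A \<le> card (A + B)"
proof -
  obtain b where "b \<in> B" using assms by blast
  then have "(+) b ` A \<subseteq> A + B"
    by (auto simp: set_plus_def) (metis add.commute)
  then have "card ((+) b ` A) \<le> card (A + B)"
    by (intro card_mono finite_set_plus assms)
  then show ?thesis by simp
qed

lemma card_hfold_sumset_mono:
  fixes A :: "'a::ab_group_add set"
  assumes "finite A" "A \<noteq> {}" "m \<le> k"
  shows "card (hfold_sumset m A) \<le> card (hfold_sumset k A)"
  using card_set_plus_le_left[of "hfold_sumset m A" "hfold_sumset (k - m) A"] assms
  by (simp add: hfold_sumset_nonempty flip: hfold_sumset_add)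

lemma set_sum_subset:
  assumes "finite I" "\<And>i. i \<in> I \<Longrightarrow> f i \<subseteq> g i"
  shows "(\<Sum>i\<in>I. f i :: 'a::comm_monoid_add set) \<subseteq> (\<Sum>i\<in>I. g i)"
  using assms by (induction I rule: finite_induct) (simp_all add: set_plus_mono2)

lemma finite_set_sum:
  assumes "finite I" "\<And>i. i \<in> I \<Longrightarrow> finite (f i)"
  shows "finite (\<Sum>i\<in>I. f i :: 'a::comm_monoid_add set)"
  using assms by (induction I rule: finite_induct) (auto intro!: finite_set_plus)

lemma set_sum_nonempty:
  assumes "finite I" "\<And>i. i \<in> I \<Longrightarrow> f i \<noteq> {}"
  shows "(\<Sum>i\<in>I. f i :: 'a::comm_monoid_add set) \<noteq> {}"
  using assms by (induction I rule: finite_induct) (fastforce simp: set_plus_def)+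

lemma set_sum_hfold_sumset:
  assumes "finite I"
  shows "(\<Sum>i\<in>I. hfold_sumset j A) = hfold_sumset (card I * j) A"
  using assms by (induction I rule: finite_induct) (auto simp: hfold_sumset_add)

text \<open>Take \<open>X'\<close> minimising the ratio \<open>|X' + B| / |X'|\<close> and add the elements of \<open>C\<close> one by one.\<close>

lemma petridis:
  fixes X B :: "'a::ab_group_add set" and K :: real
  assumes X: "finite X" "X \<noteq> {}" and B: "finite B" "real (card (X + B)) \<le> K * card X"
  shows "\<exists>X'\<subseteq>X. X' \<noteq> {} \<and> (\<forall>C. finite C \<longrightarrow> real (card (C + X' + B)) \<le> K * card (C + X'))"
proof -
  define R where "R Y = real (card (Y + B)) / card Y" for Y
  define F where "F = {Y. Y \<subseteq> X \<and> Y \<noteq> {}}"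
  have F: "finite F" "F \<noteq> {}" using X by (auto simp: F_def)
  obtain X' where X': "X' \<in> F" "\<And>Y. Y \<in> F \<Longrightarrow> R X' \<le> R Y"
    using ex_is_arg_min_if_finite[OF F, of R] by (auto simp: is_arg_min_linorder)
  have finX': "finite X'" and cX': "card X' > 0"
    using X' X by (auto simp: F_def card_gt_0_iff dest: finite_subset)
  have cX: "card X > 0" using X by (simp add: card_gt_0_iff)
  have "R X' \<le> R X" using X' X by (auto simp: F_def)
  also have "R X \<le> K" using B cX by (simp add: R_def divide_le_eq)
  finally have RK: "R X' \<le> K" .
  have min: "R X' * card Y \<le> card (Y + B)" if "Y \<subseteq> X'" for Y
  proof (cases "Y = {}")
    case False
    then have "card Y > 0" using that finX' by (metis card_gt_0_iff finite_subset)
    moreover have "R X' \<le> R Y" using that False X' by (auto simp: F_def)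
    ultimately show ?thesis by (simp add: R_def[of Y] le_divide_eq)
  qed auto
  have key: "real (card (C + X' + B)) \<le> R X' * card (C + X')" if "finite C" for C
    using that
  proof (induction C rule: finite_induct)
    case (insert c C)
    \<comment> \<open>\<open>W\<close> holds the \<open>x\<close> for which \<open>c + x\<close> is
      already present; then \<open>c + w + b\<close> already lies in \<open>C + X' + B\<close>.
      Hence new sums come only from \<open>X' + B - (W + B)\<close>, and \<open>min\<close> applied
      to \<open>W\<close> bounds the saving from below.\<close>
    define W where "W = {x\<in>X'. c + x \<in> C + X'}"
    have W: "W \<subseteq> X'" by (auto simp: W_def)
    have eq: "insert c C + Y = (+) c ` Y \<union> (C + Y)" for Y
      by (auto simp: set_plus_def)
    have eq1: "insert c C + X' = (C + X') \<union> (+) c ` (X' - W)"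
      unfolding eq by (auto simp: W_def)
    have dis: "(C + X') \<inter> (+) c ` (X' - W) = {}" by (auto simp: W_def)
    have c1: "card (insert c C + X') = card (C + X') + (card X' - card W)"
      unfolding eq1 using dis finX' insert W
      by (subst card_Un_disjoint) (auto simp: finite_set_plus card_Diff_subset finite_subset)
    have WX: "card W \<le> card X'" using W finX' by (rule card_mono[rotated])
    have WB: "W + B \<subseteq> X' + B" using W by (intro set_plus_mono2) auto
    have fXB: "finite (X' + B)" using finX' B(1) by (rule finite_set_plus)
    have sub: "insert c C + X' + B \<subseteq> (C + X' + B) \<union> (+) c ` (X' + B - (W + B))"
    proof
      fix y assume "y \<in> insert c C + X' + B"
      then obtain d x b where d: "d \<in> insert c C" "x \<in> X'" "b \<in> B" "y = d + x + b"
        by (auto simp: set_plus_def)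
      show "y \<in> (C + X' + B) \<union> (+) c ` (X' + B - (W + B))"
      proof (cases "d \<in> C")
        case True
        then show ?thesis using d by (auto simp: set_plus_def)
      next
        case False
        then have dc: "d = c" using d by simp
        show ?thesis
        proof (cases "x + b \<in> W + B")
          case True
          then obtain w b' where w: "w \<in> W" "b' \<in> B" "x + b = w + b'"
            by (auto simp: set_plus_def)
          then have "c + w \<in> C + X'" by (simp add: W_def)
          then have "(c + w) + b' \<in> C + X' + B" using w(2) by (rule set_plus_intro)
          then show ?thesis using d dc w by (simp add: add.assoc)
        next
          case False
          have "x + b \<in> X' + B - (W + B)" using d False by (auto intro: set_plus_intro)
          then have "c + (x + b) \<in> (+) c ` (X' + B - (W + B))" by blast
          then show ?thesis using d dc by (simp add: add.assoc)
        qed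
      qed
    qed
    have "card (insert c C + X' + B) \<le> card (C + X' + B) + card ((+) c ` (X' + B - (W + B)))"
      using insert finX' B
      by (intro order.trans[OF card_mono[OF _ sub] card_Un_le]) (auto intro!: finite_set_plus)
    also have "card ((+) c ` (X' + B - (W + B))) = card (X' + B) - card (W + B)"
      using WB fXB by (simp add: card_Diff_subset finite_subset)
    finally have "real (card (insert c C + X' + B)) \<le> card (C + X' + B) + (card (X' + B) - card (W + B))"
      by (metis of_nat_add of_nat_le_iff)
    also have "\<dots> = real (card (C + X' + B)) + (real (card (X' + B)) - card (W + B))"
      using card_mono[OF fXB WB] by (simp add: of_nat_diff)
    also have "\<dots> \<le> R X' * card (C + X') + (R X' * card X' - R X' * card W)"
      using insert min[OF W] cX' by (intro add_mono diff_mono) (auto simp: R_def)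
    also have "\<dots> = R X' * card (insert c C + X')"
      unfolding c1 using WX by (simp add: of_nat_diff algebra_simps)
    finally show ?case .
  qed auto
  have "X' \<subseteq> X" "X' \<noteq> {}" using X' by (auto simp: F_def)
  moreover have "real (card (C + X' + B)) \<le> K * card (C + X')" if "finite C" for C
    using key[OF that] mult_right_mono[OF RK, of "card (C + X')"] by simp
  ultimately show ?thesis by blast
qed

text \<open>Petridis' set \<open>X\<close> absorbs the copies of \<open>A\<close> one at a time,
  each at the cost of a factor \<open>K\<close>.\<close>

lemma plunnecke_sumset:
  fixes A :: "'a::ab_group_add set" and K :: real
  assumes "finite A" "A \<noteq> {}" "real (card (A + A)) \<le> K * card A"
  shows "real (card (hfold_sumset m A)) \<le> K ^ m * card A"
proof -
  obtain X where X: "X \<subseteq> A" "X \<noteq> {}"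
    "\<And>C. finite C \<Longrightarrow> real (card (C + X + A)) \<le> K * card (C + X)"
    using petridis[OF assms(1,2,1,3)] by blast
  have finX: "finite X" using X assms finite_subset by blast
  have "0 \<le> K * card A" using assms(3) by (rule order.trans[rotated]) simp
  then have K: "K \<ge> 0" using assms by (simp add: zero_le_mult_iff card_gt_0_iff)
  have *: "real (card (hfold_sumset m A + X)) \<le> K ^ m * card X" for m
  proof (induction m)
    case (Suc m)
    have "real (card (hfold_sumset (Suc m) A + X)) = card (hfold_sumset m A + X + A)"
      by (simp add: hfold_sumset_Suc ac_simps)
    also have "\<dots> \<le> K * card (hfold_sumset m A + X)"
      by (rule X) (simp add: assms)
    also have "\<dots> \<le> K * (K ^ m * card X)" by (intro mult_left_mono Suc K)
    finally show ?case by (simp add: mult_ac)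
  qed (simp flip: set_zero)
  have "real (card (hfold_sumset m A)) \<le> card (hfold_sumset m A + X)"
    using card_set_plus_le_left[of "hfold_sumset m A" X] X assms finX by simp
  also have "\<dots> \<le> K ^ m * card X" by (rule *)
  also have "\<dots> \<le> K ^ m * card A"
    using K X assms by (intro mult_left_mono) (auto intro: card_mono)
  finally show ?thesis .
qed

text \<open>Each new \<open>D (\<beta> i)\<close> is absorbed by \<open>U (\<beta> i)\<close>, with
  the rest of the sum playing the role of \<open>C\<close>. One \<open>U b\<close> serves every
  \<open>i\<close> with \<open>\<beta> i = b\<close>, so the sum of the \<open>U b\<close> does not
  grow with \<open>I\<close>.\<close>

lemma card_sum_dilates_le:
  fixes U D :: "'b \<Rightarrow> 'a::ab_group_add set" and K :: real
  assumes I: "finite I" and S: "finite S" "\<beta> ` I \<subseteq> S" and K: "K \<ge> 0"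
    and fin: "\<And>b. b \<in> S \<Longrightarrow> finite (U b)" "\<And>b. b \<in> S \<Longrightarrow> finite (D b)"
    and ne: "\<And>b. b \<in> S \<Longrightarrow> U b \<noteq> {}"
    and abs: "\<And>b C. b \<in> S \<Longrightarrow> finite C \<Longrightarrow> real (card (C + U b + D b)) \<le> K * card (C + U b)"
  shows "real (card (\<Sum>i\<in>I. D (\<beta> i))) \<le> K ^ card I * card (\<Sum>b\<in>S. U b)"
proof -
  have *: "real (card ((\<Sum>b\<in>S. U b) + (\<Sum>i\<in>I. D (\<beta> i)))) \<le> K ^ card I * card (\<Sum>b\<in>S. U b)"
    using I S(2)
  proof (induction I rule: finite_induct)
    case (insert i I)
    have iS: "\<beta> i \<in> S" using insert by auto
    have split: "(\<Sum>b\<in>S. U b) = (\<Sum>b\<in>S - {\<beta> i}. U b) + U (\<beta> i)"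
      using sum.remove[OF S(1) iS, of U] by (simp add: add.commute)
    have "real (card ((\<Sum>b\<in>S. U b) + (\<Sum>i\<in>insert i I. D (\<beta> i)))) =
      card (((\<Sum>b\<in>S - {\<beta> i}. U b) + (\<Sum>i\<in>I. D (\<beta> i))) + U (\<beta> i) + D (\<beta> i))"
      using insert by (simp add: split ac_simps)
    also have "\<dots> \<le> K * card (((\<Sum>b\<in>S - {\<beta> i}. U b) + (\<Sum>i\<in>I. D (\<beta> i))) + U (\<beta> i))"
      using insert S fin by (intro abs iS finite_set_plus finite_set_sum) auto
    also have "((\<Sum>b\<in>S - {\<beta> i}. U b) + (\<Sum>i\<in>I. D (\<beta> i))) + U (\<beta> i) = (\<Sum>b\<in>S. U b) + (\<Sum>i\<in>I. D (\<beta> i))"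
      by (simp add: split ac_simps)
    also have "K * card \<dots> \<le> K * (K ^ card I * card (\<Sum>b\<in>S. U b))"
      using insert K by (intro mult_left_mono) auto
    finally show ?case using insert by (simp add: mult_ac)
  qed (simp flip: set_zero)
  have "card (\<Sum>i\<in>I. D (\<beta> i)) \<le> card ((\<Sum>i\<in>I. D (\<beta> i)) + (\<Sum>b\<in>S. U b))"
    using I S fin ne by (intro card_set_plus_le_left finite_set_sum set_sum_nonempty) auto
  with * show ?thesis by (simp add: add.commute)
qed

section \<open>Popular progressions, separated subsets and stable subsets\<close>

text \<open>Double counting: if all intersections of distinct members were small, the second moment
  of the multiplicity \<open>d\<close> would violate Cauchy-Schwarz. The bound
  \<open>card W * s \<ge> 2 * card \<Omega>\<close> makes the diagonal pairs take up at most half of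
  it.\<close>

lemma ex_large_intersection:
  fixes D :: "'i \<Rightarrow> 'a set"
  assumes "finite W" "finite \<Omega>" "\<And>i. i \<in> W \<Longrightarrow> D i \<subseteq> \<Omega>" "\<And>i. i \<in> W \<Longrightarrow> card (D i) = s"
    and s: "s > 0" and W: "card W > 0" "card W * s \<ge> 2 * card \<Omega>"
  shows "\<exists>i\<in>W. \<exists>j\<in>W. i \<noteq> j \<and> s\<^sup>2 \<le> 2 * card \<Omega> * card (D i \<inter> D j)"
proof (rule ccontr)
  assume "\<not> ?thesis"
  then have neg: "2 * card \<Omega> * card (D i \<inter> D j) < s\<^sup>2" if "i \<in> W" "j \<in> W" "i \<noteq> j" for i j
    using that by force
  define w where "w = card W"
  define d where "d x = card {i\<in>W. x \<in> D i}" for x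
  have d: "d x = (\<Sum>i\<in>W. of_bool (x \<in> D i))" for x
    using assms by (simp add: d_def Int_def)
  have "(\<Sum>x\<in>\<Omega>. d x) = (\<Sum>i\<in>W. \<Sum>x\<in>\<Omega>. of_bool (x \<in> D i))"
    unfolding d by (rule sum.swap)
  also have "\<dots> = (\<Sum>i\<in>W. s)"
  proof (rule sum.cong)
    fix i assume i: "i \<in> W"
    then have "\<Omega> \<inter> {x. x \<in> D i} = D i" using assms by auto
    then show "(\<Sum>x\<in>\<Omega>. of_bool (x \<in> D i)) = s" using assms i by simp
  qed simp
  finally have sum1: "(\<Sum>x\<in>\<Omega>. d x) = w * s" by (simp add: w_def)
  have "(\<Sum>x\<in>\<Omega>. (d x)\<^sup>2) = (\<Sum>x\<in>\<Omega>. \<Sum>i\<in>W. \<Sum>j\<in>W. of_bool (x \<in> D i \<inter> D j))"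
    unfolding d power2_eq_square sum_product by (simp add: of_bool_conj)
  also have "\<dots> = (\<Sum>i\<in>W. \<Sum>j\<in>W. \<Sum>x\<in>\<Omega>. of_bool (x \<in> D i \<inter> D j))"
    by (subst sum.swap) (subst sum.swap, rule refl)
  also have "\<dots> = (\<Sum>i\<in>W. \<Sum>j\<in>W. card (D i \<inter> D j))"
  proof (intro sum.cong refl)
    fix i j assume i: "i \<in> W"
    then have "\<Omega> \<inter> {x. x \<in> D i \<and> x \<in> D j} = D i \<inter> D j" using assms by auto
    then show "(\<Sum>x\<in>\<Omega>. of_bool (x \<in> D i \<inter> D j)) = card (D i \<inter> D j)"
      using assms by simp
  qed
  finally have sum2: "(\<Sum>x\<in>\<Omega>. (d x)\<^sup>2) = (\<Sum>i\<in>W. \<Sum>j\<in>W. card (D i \<inter> D j))" .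
  have row: "2 * card \<Omega> * (\<Sum>j\<in>W. card (D i \<inter> D j)) \<le> 2 * card \<Omega> * s + (w - 1) * (s\<^sup>2 - 1)"
    if i: "i \<in> W" for i
  proof -
    have "(\<Sum>j\<in>W. card (D i \<inter> D j)) = s + (\<Sum>j\<in>W - {i}. card (D i \<inter> D j))"
      using i assms by (subst sum.remove[of W i]) auto
    moreover have "2 * card \<Omega> * (\<Sum>j\<in>W - {i}. card (D i \<inter> D j)) \<le> (\<Sum>j\<in>W - {i}. s\<^sup>2 - 1)"
      unfolding sum_distrib_left using neg i by (intro sum_mono) (force simp: Suc_le_eq[symmetric])
    moreover have "card (W - {i}) = w - 1" using i assms by (simp add: w_def)
    ultimately show ?thesis by (simp add: distrib_left)
  qed
  have w: "w > 0" using W by (simp add: w_def)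
  have "real ((w * s)\<^sup>2) \<le> real (card \<Omega> * (\<Sum>x\<in>\<Omega>. (d x)\<^sup>2))"
    using sum_squared_le_sum_of_squares[of "\<lambda>x. real (d x)" \<Omega>] assms
    by (simp add: mult.commute sum1 flip: of_nat_sum of_nat_power of_nat_mult)
  then have "2 * (w * s)\<^sup>2 \<le> 2 * card \<Omega> * (\<Sum>x\<in>\<Omega>. (d x)\<^sup>2)" unfolding of_nat_le_iff by simp
  also have "\<dots> = (\<Sum>i\<in>W. 2 * card \<Omega> * (\<Sum>j\<in>W. card (D i \<inter> D j)))"
    by (simp add: sum2 sum_distrib_left)
  also have "\<dots> \<le> (\<Sum>i\<in>W. 2 * card \<Omega> * s + (w - 1) * (s\<^sup>2 - 1))" by (rule sum_mono) (rule row)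
  also have "\<dots> = w * s * (2 * card \<Omega>) + w * ((w - 1) * (s\<^sup>2 - 1))"
    by (simp add: w_def algebra_simps)
  also have "\<dots> \<le> w * s * (w * s) + w * ((w - 1) * (s\<^sup>2 - 1))"
    using W by (intro add_mono mult_left_mono) (auto simp: w_def)
  also have "w * ((w - 1) * (s\<^sup>2 - 1)) < w * (w * s\<^sup>2)"
  proof (intro mult_strict_left_mono w)
    have "(w - 1) * (s\<^sup>2 - 1) \<le> (w - 1) * s\<^sup>2" by simp
    also have "\<dots> < w * s\<^sup>2" using w s by simp
    finally show "(w - 1) * (s\<^sup>2 - 1) < w * s\<^sup>2" .
  qed
  finally show False by (simp add: power2_eq_square algebra_simps)
qed

text \<open>The shift \<open>real b * l\<close> is a \<open>b\<close>-fold sum of \<open>l\<close>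
  with itself. This places the translates for all \<open>l\<close> in one common sumset.\<close>

lemma translate_subset_hfold_sumset:
  fixes L :: "real set"
  assumes "l \<in> L"
  shows "(+) (real b * l) ` L \<subseteq> hfold_sumset (Suc b) L"
proof -
  have "real b * l \<in> hfold_sumset b L"
  proof (induction b)
    case (Suc b)
    then have "real b * l + l \<in> hfold_sumset (Suc b) L"
      unfolding hfold_sumset_Suc using assms by (intro set_plus_intro)
    then show ?case by (simp add: algebra_simps)
  qed simp
  then show ?thesis by (auto simp: hfold_sumset_Suc intro: set_plus_intro)
qed

text \<open>Pigeonhole on the product sets \<open>(L + 0) \<times> (L + l) \<times> \<dots> \<times> (L + B l)\<close>, \<open>l \<in> W\<close>: together they live
  in \<open>L \<times> 2L \<times> \<dots> \<times> (B + 1)L\<close>, so two of them have a large intersection. Treating all \<open>b \<le> B\<close> at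
  once only ever asks for pairwise intersections; a long progression inside \<open>L\<close> itself need not
  exist, because \<open>L\<close> may look like a Behrend set.\<close>

lemma ex_popular_progression:
  fixes L :: "real set" and K :: real
  assumes L: "finite L" "L \<noteq> {}" "real (card (L + L)) \<le> K * card L"
    and W: "W \<subseteq> L" "real (card W) \<ge> 2 * K ^ ((B + 1)\<^sup>2)"
  shows "\<exists>l\<in>W. \<exists>l'\<in>W. l < l' \<and>
    (\<forall>b\<le>B. real (card L) \<le> 2 * K ^ ((B + 1)\<^sup>2) * card (L \<inter> (+) (real b * (l' - l)) ` L))"
proof -
  define N where "N = card L"
  have N: "N > 0" using L by (simp add: N_def card_gt_0_iff)
  define E where "E = (B + 1)\<^sup>2"
  define \<Omega> where "\<Omega> = PiE {..B} (\<lambda>b. hfold_sumset (Suc b) L)"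
  define D where "D l = PiE {..B} (\<lambda>b. (+) (real b * l) ` L)" for l
  have "real N \<le> card (L + L)" unfolding N_def using L by (intro of_nat_mono card_set_plus_le_left)
  also have "\<dots> \<le> K * N" using L by (simp add: N_def)
  finally have K: "K \<ge> 1" using N by simp
  have finW: "finite W" using W L finite_subset by blast
  have fin\<Omega>: "finite \<Omega>" unfolding \<Omega>_def using L by (intro finite_PiE) auto
  \<comment> \<open>Coordinate \<open>b\<close> of \<open>\<Omega>\<close> costs
    \<open>K ^ Suc b\<close> by \<open>plunnecke_sumset\<close>; this is the total exponent.\<close>
  have sumE: "(\<Sum>b\<le>B. Suc b) \<le> E"
  proof -
    have "(\<Sum>b\<le>B. Suc b) \<le> (\<Sum>b\<le>B. B + 1)" by (intro sum_mono) auto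
    then show ?thesis by (simp add: E_def power2_eq_square)
  qed
  have "real (card \<Omega>) = (\<Prod>b\<le>B. real (card (hfold_sumset (Suc b) L)))"
    by (simp add: \<Omega>_def card_PiE)
  also have "\<dots> \<le> (\<Prod>b\<le>B. K ^ Suc b * N)"
    unfolding N_def using L by (intro prod_mono) (simp add: plunnecke_sumset del: power_Suc)
  also have "\<dots> = K ^ (\<Sum>b\<le>B. Suc b) * real N ^ (B + 1)"
    by (simp add: prod.distrib power_sum del: power_Suc)
  also have "\<dots> \<le> K ^ E * real N ^ (B + 1)"
    using sumE K by (intro mult_right_mono power_increasing) auto
  finally have c\<Omega>: "real (card \<Omega>) \<le> K ^ E * real N ^ (B + 1)" .
  have cD: "card (D l) = N ^ (B + 1)" for l
    by (simp add: D_def card_PiE N_def)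
  have sub: "D l \<subseteq> \<Omega>" if "l \<in> W" for l
    unfolding D_def \<Omega>_def using translate_subset_hfold_sumset that W
    by (intro PiE_mono) blast
  have "0 < 2 * K ^ E" using K by simp
  also have "\<dots> \<le> card W" using W by (simp add: E_def)
  finally have W0: "card W > 0" by simp
  have "real (2 * card \<Omega>) \<le> 2 * K ^ E * real N ^ (B + 1)" using c\<Omega> by simp
  also have "\<dots> \<le> card W * real N ^ (B + 1)"
    using W by (intro mult_right_mono) (auto simp: E_def)
  finally have "real (2 * card \<Omega>) \<le> real (card W * N ^ (B + 1))" by simp
  then have "2 * card \<Omega> \<le> card W * N ^ (B + 1)" unfolding of_nat_le_iff .
  then obtain i j where ij: "i \<in> W" "j \<in> W" "i \<noteq> j" "(N ^ (B + 1))\<^sup>2 \<le> 2 * card \<Omega> * card (D i \<inter> D j)"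
    using ex_large_intersection[of W \<Omega> D, OF finW fin\<Omega> sub cD _ W0] N by (metis zero_less_power)
  define l where "l = min i j"
  define l' where "l' = max i j"
  have ll: "l \<in> W" "l' \<in> W" "l < l'" "(N ^ (B + 1))\<^sup>2 \<le> 2 * card \<Omega> * card (D l \<inter> D l')"
    using ij by (auto simp: l_def l'_def min_def max_def Int_commute)
  have "real N \<le> 2 * K ^ E * card (L \<inter> (+) (real b * (l' - l)) ` L)" if b: "b \<le> B" for b
  proof -
    define I where "I b = (+) (real b * l) ` L \<inter> (+) (real b * l') ` L" for b
    have Ib: "card (I b) = card (L \<inter> (+) (real b * (l' - l)) ` L)"
    proof -
      have "I b = (+) (real b * l) ` (L \<inter> (+) (real b * (l' - l)) ` L)"
        unfolding I_def by (subst image_Int) (auto simp: image_image algebra_simps)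
      then show ?thesis by simp
    qed
    have IN: "card (I c) \<le> N" for c
      using card_mono[of "(+) (real c * l) ` L" "I c"] L by (simp add: I_def N_def)
    \<comment> \<open>An intersection of boxes is the box of intersections. Every other factor is at
      most \<open>N\<close>, so a large product forces the factor at \<open>b\<close> to be
      large.\<close>
    have "card (D l \<inter> D l') = (\<Prod>b\<le>B. card (I b))"
      by (simp add: D_def PiE_Int card_PiE I_def)
    also have "\<dots> = card (I b) * (\<Prod>b\<in>{..B} - {b}. card (I b))" using b by (simp add: prod.remove)
    also have "\<dots> \<le> card (I b) * (\<Prod>b\<in>{..B} - {b}. N)" by (intro mult_left_mono prod_mono) (simp_all add: IN)
    also have "\<dots> = card (I b) * N ^ B" using b by simp
    finally have "real (card (D l \<inter> D l')) \<le> real (card (I b) * N ^ B)" by (rule of_nat_mono)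
    then have "2 * real (card \<Omega>) * card (D l \<inter> D l') \<le> 2 * (K ^ E * real N ^ (B + 1)) * (card (I b) * real N ^ B)"
      using c\<Omega> K by (intro mult_mono) auto
    moreover have "real ((N ^ (B + 1))\<^sup>2) \<le> real (2 * card \<Omega> * card (D l \<inter> D l'))"
      using ll(4) by (rule of_nat_mono)
    ultimately have "real N ^ (B + 1) * real N ^ B * real N \<le> real N ^ (B + 1) * real N ^ B * (2 * K ^ E * card (I b))"
      by (simp add: power2_eq_square mult_ac)
    then show ?thesis using N Ib by simp
  qed
  then show ?thesis using ll unfolding N_def E_def by blast
qed

text \<open>Greedy choice from the left: keep the minimum \<open>m\<close> and discard the rest of
  \<open>{m..<m + d}\<close>, which uses up at most \<open>w\<close> points per point kept.\<close>

lemma ex_separated_subset: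
  fixes L :: "real set"
  assumes "finite L" "\<And>x. real (card (L \<inter> {x..<x + d})) \<le> w" "d > 0"
  shows "\<exists>S\<subseteq>L. (\<forall>s\<in>S. \<forall>s'\<in>S. s < s' \<longrightarrow> s + d \<le> s') \<and> real (card L) \<le> w * card S"
  using assms
proof (induction L rule: finite_psubset_induct)
  case (psubset L)
  show ?case
  proof (cases "L = {}")
    case False
    define m where "m = Min L"
    have m: "m \<in> L" "\<And>l. l \<in> L \<Longrightarrow> m \<le> l" using False psubset by (auto simp: m_def)
    define L' where "L' = {l\<in>L. m + d \<le> l}"
    have "L' \<subset> L" using m \<open>d > 0\<close> by (force simp: L'_def)
    moreover have "real (card (L' \<inter> {x..<x + d})) \<le> w" for x
    proof -
      have "card (L' \<inter> {x..<x + d}) \<le> card (L \<inter> {x..<x + d})"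
        using psubset by (intro card_mono) (auto simp: L'_def)
      then show ?thesis using psubset.prems(1)[of x] by linarith
    qed
    ultimately obtain S where S: "S \<subseteq> L'" "\<forall>s\<in>S. \<forall>s'\<in>S. s < s' \<longrightarrow> s + d \<le> s'"
      "real (card L') \<le> w * card S" using psubset.IH[of L'] psubset.prems by blast
    have finS: "finite S" using S psubset.hyps finite_subset by (fastforce simp: L'_def)
    have "L = (L \<inter> {m..<m + d}) \<union> L'" using m by (force simp: L'_def)
    then have "real (card L) \<le> card (L \<inter> {m..<m + d}) + real (card L')"
      by (metis card_Un_le of_nat_add of_nat_le_iff)
    also have "\<dots> \<le> w + w * card S" using psubset.prems S by (intro add_mono)
    also have "\<dots> = w * card (insert m S)"
      using finS S \<open>d > 0\<close> by (subst card_insert_disjoint) (auto simp: L'_def algebra_simps)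
    finally have "real (card L) \<le> w * card (insert m S)" .
    moreover have "\<forall>s\<in>insert m S. \<forall>s'\<in>insert m S. s < s' \<longrightarrow> s + d \<le> s'"
      using S m \<open>d > 0\<close> by (fastforce simp: L'_def)
    moreover have "insert m S \<subseteq> L" using m S by (auto simp: L'_def)
    ultimately show ?thesis by blast
  qed auto
qed

text \<open>Serves to show that many separated points in a short interval force \<open>d\<close> to
  be small.\<close>

lemma separated_card_le:
  fixes S :: "real set"
  assumes "finite S" "S \<noteq> {}" "\<forall>s\<in>S. \<forall>s'\<in>S. s < s' \<longrightarrow> s + d \<le> s'"
  shows "(real (card S) - 1) * d \<le> Max S - Min S"
  using assms
proof (induction S rule: finite_linorder_max_induct)
  case (insert b A)
  show ?case
  proof (cases "A = {}")
    case False
    have "Max A \<in> A" "Max A < b" using insert False by auto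
    then have "Max A + d \<le> b" using insert by auto
    moreover have "(real (card A) - 1) * d \<le> Max A - Min A" using insert False by auto
    moreover have "Max (insert b A) = b" using insert by (intro Max_eqI) (auto intro: less_imp_le)
    moreover have "Min (insert b A) = Min A"
      using insert False \<open>Max A < b\<close> by (simp add: min_def) (meson Min_in not_less order.asym)
    moreover have "card (insert b A) = Suc (card A)" using insert by (intro card_insert_disjoint) auto
    ultimately show ?thesis by (simp add: algebra_simps)
  qed simp
qed simp

text \<open>As long as some slightly smaller subset makes one of the sumsets drop by a factor \<open>n powr \<delta>\<close>, pass
  to that subset. The product of all the sumset sizes decreases each time, so this stops within \<open>M\<close>
  rounds, while the exponent \<open>\<alpha>\<close> of the density loss grows by a factor \<open>C\<close> per round.\<close>

lemma ex_stable_subset: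
  fixes A :: "real set" and n q \<delta> C \<epsilon> :: real
  assumes A: "finite A" and n: "n > 1" and C: "C \<ge> 1" and \<epsilon>: "\<epsilon> > 0"
    and cA: "n powr (1 - \<epsilon>) \<le> card A"
    and q: "\<And>j. j \<le> J \<Longrightarrow> card (hfold_sumset j A) \<le> n powr q"
    and M: "real M * \<delta> > real (Suc J) * q" and \<delta>: "\<delta> > 0"
  shows "\<exists>A'\<subseteq>A. \<exists>\<alpha>. \<epsilon> \<le> \<alpha> \<and> \<alpha> \<le> C ^ M * \<epsilon> \<and> n powr (1 - \<alpha>) \<le> card A' \<and>
    (\<forall>A''\<subseteq>A'. n powr (1 - C * \<alpha>) \<le> card A'' \<longrightarrow>
      (\<forall>j\<le>J. card (hfold_sumset j A') \<le> n powr \<delta> * card (hfold_sumset j A'')))"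
proof -
  define \<Phi> where "\<Phi> A' = (\<Prod>j\<le>J. real (card (hfold_sumset j A')))" for A' :: "real set"
  \<comment> \<open>\<open>V i\<close> is the invariant after \<open>i\<close> rounds. For nonempty
    \<open>A'\<close> the product \<open>\<Phi> A'\<close> is at least 1, so the hypothesis on
    \<open>M\<close> leaves room for at most \<open>M\<close> rounds, and a largest \<open>i\<close>
    exists.\<close>
  define V where "V i \<longleftrightarrow> (\<exists>A'\<subseteq>A. n powr (1 - C ^ i * \<epsilon>) \<le> card A' \<and>
    \<Phi> A' \<le> n powr (real (Suc J) * q - i * \<delta>))" for i :: nat
  have ne: "A' \<noteq> {}" if "n powr x \<le> card A'" for A' :: "real set" and x
    using that n by (auto simp: powr_gt_zero)
  have fin: "finite A'" if "A' \<subseteq> A" for A' using that A finite_subset by blast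
  have pos: "card (hfold_sumset j A') > 0" if "A' \<subseteq> A" "A' \<noteq> {}" for A' j
    using that fin by (simp add: card_gt_0_iff hfold_sumset_nonempty)
  have V0: "V 0"
  proof -
    have "\<Phi> A \<le> (\<Prod>j\<le>J. n powr q)" unfolding \<Phi>_def using q by (intro prod_mono) auto
    also have "\<dots> = n powr (real (Suc J) * q)"
      using n by (simp add: powr_power mult.commute del: power_Suc)
    finally show ?thesis unfolding V_def using cA by (intro exI[of _ A]) auto
  qed
  have bound: "i \<le> M" if "V i" for i
  proof (rule ccontr)
    assume "\<not> i \<le> M"
    obtain A' where A': "A' \<subseteq> A" "n powr (1 - C ^ i * \<epsilon>) \<le> card A'"
      "\<Phi> A' \<le> n powr (real (Suc J) * q - i * \<delta>)" using \<open>V i\<close> unfolding V_def by metis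
    have "real M * \<delta> \<le> i * \<delta>" using \<open>\<not> i \<le> M\<close> \<delta> by (intro mult_right_mono) auto
    then have "n powr (real (Suc J) * q - i * \<delta>) < n powr 0"
      using M n by (intro powr_less_mono) auto
    moreover have "\<Phi> A' \<ge> 1" unfolding \<Phi>_def
      using pos[OF A'(1) ne[OF A'(2)]] by (intro prod_ge_1) (simp add: Suc_le_eq)
    ultimately show False using A' n by simp
  qed
  define i where "i = Greatest V"
  have i: "V i" "\<And>k. V k \<Longrightarrow> k \<le> i"
    unfolding i_def by (rule GreatestI_nat[of V 0 M] Greatest_le_nat[of V _ M], use V0 bound in auto)+
  obtain A' where A': "A' \<subseteq> A" "n powr (1 - C ^ i * \<epsilon>) \<le> card A'"
    "\<Phi> A' \<le> n powr (real (Suc J) * q - i * \<delta>)" using i(1) unfolding V_def by metis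
  have "card (hfold_sumset k A') \<le> n powr \<delta> * card (hfold_sumset k A'')"
    if A'': "A'' \<subseteq> A'" "n powr (1 - C * (C ^ i * \<epsilon>)) \<le> card A''" and k: "k \<le> J" for A'' k
  proof (rule ccontr)
    assume neg: "\<not> ?thesis"
    have sub: "A'' \<subseteq> A" using A'' A' by blast
    let ?h = "\<lambda>j A. real (card (hfold_sumset j A))"
    \<comment> \<open>Shrinking the set enlarges no factor of \<open>\<Phi>\<close>, so a drop of
      the \<open>k\<close>-th factor alone already yields \<open>V (Suc i)\<close>.\<close>
    have "\<Phi> A'' = ?h k A'' * (\<Prod>j\<in>{..J} - {k}. ?h j A'')"
      unfolding \<Phi>_def using k by (simp add: prod.remove)
    also have "\<dots> \<le> (n powr - \<delta> * ?h k A') * (\<Prod>j\<in>{..J} - {k}. ?h j A')"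
    proof (intro mult_mono prod_mono prod_nonneg conjI)
      show "?h k A'' \<le> n powr - \<delta> * ?h k A'"
        using neg n by (simp add: powr_minus field_simps)
      show "?h j A'' \<le> ?h j A'" for j
        using A'' A' fin by (intro of_nat_mono card_mono hfold_sumset_mono) auto
    qed auto
    also have "\<dots> = n powr - \<delta> * \<Phi> A'"
      unfolding \<Phi>_def using k by (simp add: prod.remove)
    also have "\<dots> \<le> n powr - \<delta> * n powr (real (Suc J) * q - i * \<delta>)"
      using A' by (intro mult_left_mono) auto
    also have "\<dots> = n powr (real (Suc J) * q - Suc i * \<delta>)"
      by (simp add: algebra_simps flip: powr_add)
    finally have "V (Suc i)" unfolding V_def using sub A'' by (auto simp: mult_ac)
    then show False using i(2) by fastforce
  qed
  moreover have "C ^ i * \<epsilon> \<ge> \<epsilon>" using C \<epsilon> by simp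
  moreover have "C ^ i * \<epsilon> \<le> C ^ M * \<epsilon>"
    using bound[OF i(1)] C \<epsilon> by (intro mult_right_mono power_increasing) auto
  ultimately show ?thesis using A' by blast
qed

section \<open>Sparse exponential sums with a prescribed order of vanishing\<close>

fun cheb_poly :: "nat \<Rightarrow> real poly" where
  "cheb_poly 0 = 1"
| "cheb_poly (Suc 0) = [:0, 1:]"
| "cheb_poly (Suc (Suc n)) = [:0, 2:] * cheb_poly (Suc n) - cheb_poly n"

lemma degree_cheb_poly: "degree (cheb_poly n) \<le> n"
proof (induction n rule: cheb_poly.induct)
  case (3 n)
  have "degree ([:0, 2:] * cheb_poly (Suc n)) \<le> Suc (Suc n)"
    using degree_mult_le[of "[:0, 2:]" "cheb_poly (Suc n)"] 3 by simp
  then show ?case using 3 by (simp add: degree_diff_le)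
qed auto

lemma poly_cheb_poly_cos: "poly (cheb_poly n) (cos t) = cos (real n * t)"
proof (induction n rule: cheb_poly.induct)
  case (3 n)
  have "cos (real n * t) + cos (real (Suc (Suc n)) * t) = 2 * cos t * cos (real (Suc n) * t)"
    using cos_plus_cos[of "real (Suc (Suc n)) * t" "real n * t"]
    by (simp add: algebra_simps add_divide_distrib)
  then show ?case using 3 by simp
qed auto

lemma abs_poly_cheb_poly_le:
  assumes "\<bar>x\<bar> \<le> 1" shows "\<bar>poly (cheb_poly n) x\<bar> \<le> 1"
  using assms poly_cheb_poly_cos[of n "arccos x"] by (simp add: abs_le_iff)

text \<open>The induction carries consecutive differences along: by the recurrence each exceeds the
  previous one by \<open>2 * y\<close> times a value that is at least 1. The odd numbers then add up
  to a square.\<close>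

lemma poly_cheb_poly_ge:
  assumes "y \<ge> 0" shows "poly (cheb_poly n) (1 + y) \<ge> 1 + (real n)\<^sup>2 * y"
proof -
  have "poly (cheb_poly n) (1 + y) \<ge> 1 + (real n)\<^sup>2 * y \<and>
    poly (cheb_poly (Suc n)) (1 + y) - poly (cheb_poly n) (1 + y) \<ge> (2 * real n + 1) * y"
  proof (induction n)
    case (Suc n)
    let ?p = "\<lambda>n. poly (cheb_poly n) (1 + y)"
    have 1: "?p (Suc n) \<ge> 1 + (real (Suc n))\<^sup>2 * y"
      using Suc by (simp add: power2_eq_square algebra_simps)
    then have "?p (Suc n) \<ge> 1" using assms by (smt (verit) mult_nonneg_nonneg zero_le_power2)
    then have "2 * y * ?p (Suc n) \<ge> 2 * y * 1" using assms by (intro mult_left_mono) auto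
    then have "?p (Suc (Suc n)) - ?p (Suc n) \<ge> (2 * real (Suc n) + 1) * y"
      using Suc by (simp add: algebra_simps)
    with 1 show ?case by blast
  qed auto
  then show ?thesis by blast
qed

section \<open>Power sums of sets of exponents\<close>

text \<open>As \<open>0 ^ 0 = 1\<close>, the zeroth moment is the cardinality even when 0 belongs to
  the set.\<close>

definition moment :: "nat \<Rightarrow> nat set \<Rightarrow> nat" where
  "moment i \<Omega> = (\<Sum>b\<in>\<Omega>. b ^ i)"

lemma sum_poly_eq_if_moments_eq:
  fixes q :: "real poly"
  assumes "degree q \<le> F" "\<And>i. i \<le> F \<Longrightarrow> moment i \<Omega> = moment i \<Omega>'"
  shows "(\<Sum>b\<in>\<Omega>. poly q (real b)) = (\<Sum>b\<in>\<Omega>'. poly q (real b))"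
proof -
  have *: "(\<Sum>b\<in>\<Omega>. poly q (real b)) = (\<Sum>i\<le>degree q. coeff q i * real (moment i \<Omega>))" for \<Omega>
    unfolding poly_altdef moment_def
    by (subst sum.swap) (simp add: sum_distrib_left)
  show ?thesis unfolding * using assms by (intro sum.cong) auto
qed

text \<open>Equal moments are tested against a power of a Chebyshev polynomial that is bounded by 1 on the
  points after the first difference \<open>b0\<close> and large at \<open>b0\<close>.\<close>

lemma eq_if_moments_eq:
  assumes "\<Omega> \<subseteq> {..4 ^ m}" "\<Omega>' \<subseteq> {..4 ^ m}"
    and mom: "\<And>i. i \<le> 2 ^ m * (2 * m + 1) \<Longrightarrow> moment i \<Omega> = moment i \<Omega>'"
  shows "\<Omega> = \<Omega>'"
proof (rule ccontr)
  assume ne: "\<Omega> \<noteq> \<Omega>'"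
  define B :: nat where "B = 4 ^ m"
  have B: "B > 0" by (simp add: B_def)
  have fin: "finite \<Omega>" "finite \<Omega>'" using assms finite_subset by blast+
  define \<Delta> where "\<Delta> = (\<Omega> - \<Omega>') \<union> (\<Omega>' - \<Omega>)"
  define c where "c b = (of_bool (b \<in> \<Omega>) - of_bool (b \<in> \<Omega>') :: real)" for b
  have \<Delta>: "finite \<Delta>" "\<Delta> \<noteq> {}" "\<Delta> \<subseteq> {..B}"
    using ne fin assms by (auto simp: \<Delta>_def B_def)
  define b0 where "b0 = Min \<Delta>"
  have b0: "b0 \<in> \<Delta>" "b0 \<le> B" "\<And>b. b \<in> \<Delta> \<Longrightarrow> b0 \<le> b"
    using \<Delta> by (auto simp: b0_def dest: Min_in)
  \<comment> \<open>The affine map sends \<open>b0 + 1, ..., B\<close> into [-1, 1] and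
    \<open>b0\<close> to \<open>1 + 2 / B\<close>, where the polynomial of index
    \<open>2 ^ m\<close> is at least 3 because \<open>(2 ^ m)\<^sup>2 = B\<close>. The power
    \<open>2 * m + 1\<close> lifts this above \<open>B = 4 ^ m\<close>, a bound for the sum of all
    other terms.\<close>
  define q where
    "q = (pcompose (cheb_poly (2 ^ m)) [:1 + 2 * (real b0 + 1) / B, - 2 / B:]) ^ (2 * m + 1)"
  have "degree q \<le> 2 ^ m * (2 * m + 1)"
  proof -
    have "degree (pcompose (cheb_poly (2 ^ m)) [:1 + 2 * (real b0 + 1) / B, - 2 / B:])
      \<le> degree (cheb_poly (2 ^ m)) * 1"
      using B by (simp add: degree_pcompose)
    also have "\<dots> \<le> 2 ^ m" by (simp add: degree_cheb_poly)
    finally show ?thesis unfolding q_def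
      by (intro order.trans[OF degree_power_le] mult_right_mono) auto
  qed
  from sum_poly_eq_if_moments_eq[OF this mom]
  have eq: "(\<Sum>b\<in>\<Omega>. poly q (real b)) = (\<Sum>b\<in>\<Omega>'. poly q (real b))" by simp
  have qb: "poly q (real b) = poly (cheb_poly (2 ^ m)) (1 + 2 * (real b0 + 1 - real b) / B) ^ (2 * m + 1)" for b
    by (simp add: q_def poly_pcompose diff_divide_distrib algebra_simps)
  have "(\<Sum>b\<le>B. c b * poly q (real b)) = 0"
  proof -
    have "(\<Sum>b\<le>B. of_bool (b \<in> \<Omega>) * poly q (real b)) = (\<Sum>b\<in>\<Omega>. poly q (real b))"
      if "\<Omega> \<subseteq> {..B}" for \<Omega>
      using that by (intro sum.mono_neutral_cong_right) auto
    then show ?thesis using eq assms by (simp add: c_def left_diff_distrib sum_subtractf B_def)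
  qed
  also have "(\<Sum>b\<le>B. c b * poly q (real b)) = c b0 * poly q b0 + (\<Sum>b\<in>{..B} - {b0}. c b * poly q (real b))"
    using b0 by (intro sum.remove) auto
  finally have z: "c b0 * poly q b0 = - (\<Sum>b\<in>{..B} - {b0}. c b * poly q (real b))" by simp
  have small: "\<bar>c b * poly q (real b)\<bar> \<le> 1" if "b \<in> {..B} - {b0}" for b
  proof (cases "b \<in> \<Delta>")
    case True
    then have b: "b0 < b" "b \<le> B" using b0 that by (auto simp: order.strict_iff_order)
    have "\<bar>1 + 2 * (real b0 + 1 - real b) / B\<bar> \<le> 1"
      using b B by (simp add: abs_le_iff divide_simps)
    then have "\<bar>poly q (real b)\<bar> \<le> 1"
      unfolding qb power_abs by (intro power_le_one abs_poly_cheb_poly_le) auto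
    then show ?thesis by (auto simp: c_def abs_mult)
  next
    case False
    then show ?thesis by (auto simp: c_def \<Delta>_def)
  qed
  have "\<bar>c b0\<bar> = 1" using b0(1) by (auto simp: c_def \<Delta>_def)
  then have "\<bar>poly q b0\<bar> = \<bar>c b0 * poly q b0\<bar>" by (simp add: abs_mult)
  also have "\<dots> \<le> (\<Sum>b\<in>{..B} - {b0}. \<bar>c b * poly q (real b)\<bar>)"
    unfolding z abs_minus_cancel by (rule sum_abs)
  also have "\<dots> \<le> (\<Sum>b\<in>{..B} - {b0}. 1)" by (intro sum_mono small)
  also have "\<dots> = B" using b0 by simp
  finally have le: "\<bar>poly q b0\<bar> \<le> 4 ^ m" by (simp add: B_def)
  have "poly (cheb_poly (2 ^ m)) (1 + 2 / B) \<ge> 1 + (real (2 ^ m))\<^sup>2 * (2 / B)"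
    by (rule poly_cheb_poly_ge) simp
  also have "(real (2 ^ m))\<^sup>2 * (2 / B) = 2"
    by (simp add: B_def power2_eq_square flip: power_mult_distrib)
  finally have "poly (cheb_poly (2 ^ m)) (1 + 2 / B) \<ge> 3" by simp
  then have "poly q b0 \<ge> 3 ^ (2 * m + 1)" unfolding qb by (intro power_mono) auto
  moreover have "(3::real) ^ (2 * m + 1) > 4 ^ m"
  proof -
    have "(4::real) ^ m \<le> 9 ^ m" by (intro power_mono) auto
    also have "\<dots> < 3 * 9 ^ m" by simp
    also have "\<dots> = 3 ^ (2 * m + 1)" by (simp add: power_mult)
    finally show ?thesis .
  qed
  ultimately show False using le by simp
qed

text \<open>The exact orders of vanishing at 1 of the polynomials
  \<open>(\<Sum>b\<in>\<Omega>. x ^ b) - (\<Sum>b\<in>\<Omega>'. x ^ b)\<close> with \<open>\<Omega>, \<Omega>' \<subseteq> {..B}\<close>.\<close>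

definition vanishing_orders :: "nat \<Rightarrow> nat set" where
  "vanishing_orders B = {f. \<exists>\<Omega> \<Omega>'. \<Omega> \<subseteq> {..B} \<and> \<Omega>' \<subseteq> {..B} \<and>
     (\<forall>i<f. moment i \<Omega> = moment i \<Omega>') \<and> moment f \<Omega> \<noteq> moment f \<Omega>'}"

text \<open>A larger order would make enough moments agree to force the two sets to
  coincide.\<close>

lemma vanishing_orders_le: "vanishing_orders (4 ^ m) \<subseteq> {..2 ^ m * (2 * m + 1)}"
proof
  fix f assume "f \<in> vanishing_orders (4 ^ m)"
  then obtain \<Omega> \<Omega>' where *: "\<Omega> \<subseteq> {..4 ^ m}" "\<Omega>' \<subseteq> {..4 ^ m}"
    "\<forall>i<f. moment i \<Omega> = moment i \<Omega>'" "moment f \<Omega> \<noteq> moment f \<Omega>'"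
    by (auto simp: vanishing_orders_def)
  show "f \<in> {..2 ^ m * (2 * m + 1)}"
    using eq_if_moments_eq[OF *(1,2)] * by (metis atMost_iff linorder_le_less_linear order.strict_trans1)
qed

text \<open>A subset of \<open>{..B}\<close> is determined by its moments at the vanishing orders alone; compare the number
  of subsets with the number of possible values of these moments.\<close>

lemma card_vanishing_orders_ge:
  "4 ^ m \<le> (2 * m + 1) * (2 ^ m * (2 * m + 1) + 2) * card (vanishing_orders (4 ^ m))"
proof -
  define B :: nat where "B = 4 ^ m"
  define F :: nat where "F = 2 ^ m * (2 * m + 1)"
  define V where "V = vanishing_orders B"
  have V: "V \<subseteq> {..F}" unfolding V_def F_def B_def by (rule vanishing_orders_le)
  then have finV: "finite V" using finite_subset by blast
  define R where "R f = {..(B + 1) * B ^ f}" for f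
  define \<Phi> where "\<Phi> \<Omega> = restrict (\<lambda>f. moment f \<Omega>) V" for \<Omega>
  \<comment> \<open>The first moment at which two distinct sets differ has an index in
    \<open>V\<close>, so \<open>\<Phi>\<close> sees it.\<close>
  have inj: "inj_on \<Phi> (Pow {..B})"
  proof (rule inj_onI, rule ccontr)
    fix \<Omega> \<Omega>' assume *: "\<Omega> \<in> Pow {..B}" "\<Omega>' \<in> Pow {..B}" "\<Phi> \<Omega> = \<Phi> \<Omega>'" "\<Omega> \<noteq> \<Omega>'"
    then have "\<exists>i. moment i \<Omega> \<noteq> moment i \<Omega>'"
      using eq_if_moments_eq[of \<Omega> m \<Omega>'] by (auto simp: B_def)
    then obtain f where "moment f \<Omega> \<noteq> moment f \<Omega>'" "\<forall>i<f. moment i \<Omega> = moment i \<Omega>'"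
      using exists_least_iff[of "\<lambda>i. moment i \<Omega> \<noteq> moment i \<Omega>'"] by auto
    moreover from this have "f \<in> V" unfolding V_def vanishing_orders_def using *(1,2) by blast
    ultimately show False using *(3) by (metis \<Phi>_def restrict_apply')
  qed
  have sub: "\<Phi> ` Pow {..B} \<subseteq> PiE V R"
  proof -
    have "moment f \<Omega> \<le> (B + 1) * B ^ f" if "\<Omega> \<subseteq> {..B}" for \<Omega> f
    proof -
      have "moment f \<Omega> \<le> (\<Sum>b\<in>\<Omega>. B ^ f)"
        unfolding moment_def using that by (intro sum_mono power_mono) auto
      also have "\<dots> = card \<Omega> * B ^ f" by simp
      also have "\<dots> \<le> card {..B} * B ^ f" using that by (intro mult_right_mono card_mono) auto
      finally show ?thesis by simp
    qed
    then show ?thesis by (auto simp: \<Phi>_def R_def)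
  qed
  have B1: "B + 1 \<le> 2 ^ (2 * m + 1)" "B \<ge> 1"
    by (auto simp: B_def power_mult)
  have "2 ^ (B + 1) = card (\<Phi> ` Pow {..B})" using inj by (simp add: card_image card_Pow)
  also have "\<dots> \<le> card (PiE V R)"
    using sub finV by (intro card_mono finite_PiE) (auto simp: R_def)
  also have "\<dots> = (\<Prod>f\<in>V. (B + 1) * B ^ f + 1)" using finV by (simp add: card_PiE R_def)
  \<comment> \<open>Enlarging each factor to the same power of \<open>B + 1\<close> reduces the
    count to a comparison of exponents of 2.\<close>
  also have "\<dots> \<le> (\<Prod>f\<in>V. (B + 1) ^ (F + 2))"
  proof (rule prod_mono, safe)
    fix f assume "f \<in> V"
    then have f: "f \<le> F" using V by auto
    have "1 \<le> (B + 1) * (B + 1) ^ f" by (simp only: power_Suc[symmetric] one_le_power)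
    then have "(B + 1) * B ^ f + 1 \<le> (B + 1) * (B + 1) ^ f + (B + 1) * (B + 1) ^ f"
      by (intro add_mono mult_left_mono power_mono) auto
    also have "\<dots> = 2 * (B + 1) ^ (f + 1)" by simp
    also have "\<dots> \<le> (B + 1) * (B + 1) ^ (f + 1)" using B1 by (intro mult_right_mono) auto
    also have "\<dots> = (B + 1) ^ (f + 2)" by simp
    also have "\<dots> \<le> (B + 1) ^ (F + 2)" using f by (intro power_increasing) auto
    finally show "(B + 1) * B ^ f + 1 \<le> (B + 1) ^ (F + 2)" .
  qed
  also have "\<dots> = (B + 1) ^ ((F + 2) * card V)" by (simp only: prod_constant power_mult)
  also have "\<dots> \<le> (2 ^ (2 * m + 1)) ^ ((F + 2) * card V)" using B1 by (intro power_mono) auto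
  also have "\<dots> = 2 ^ ((2 * m + 1) * (F + 2) * card V)" by (simp only: power_mult[symmetric] mult.assoc)
  finally have "B + 1 \<le> (2 * m + 1) * (F + 2) * card V"
    by (rule power_le_imp_le_exp[rotated]) simp
  then show ?thesis by (simp add: B_def F_def V_def)
qed

text \<open>There are at least \<open>2 ^ m\<close> orders up to a factor quadratic in
  \<open>m\<close>. With \<open>m = 2 * t + 13\<close>, the factor \<open>2 ^ (t + 12)\<close> pays
  for the quadratic, and one more factor 2 for keeping a single parity class, which creates the gaps
  of two.\<close>

lemma many_vanishing_orders:
  "\<exists>F \<subseteq> vanishing_orders (2 ^ (4 * t + 26)).
    finite F \<and> card F = 2 ^ t \<and> (\<forall>f\<in>F. \<forall>g\<in>F. f < g \<longrightarrow> f + 2 \<le> g)"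
proof -
  define m where "m = 2 * t + 13"
  define V where "V = vanishing_orders (2 ^ (4 * t + 26))"
  have "(4::nat) ^ m = (2\<^sup>2) ^ m" by simp
  also have "\<dots> = 2 ^ (4 * t + 26)" by (simp only: power_mult[symmetric] m_def) simp
  finally have m: "(4::nat) ^ m = 2 ^ (4 * t + 26)" .
  have finV: "finite V" using vanishing_orders_le[of m] finite_subset unfolding m V_def by blast
  have "(2 * m + 1) * (2 ^ m * (2 * m + 1) + 2) \<le> (2 * m + 3) * (2 ^ m * (2 * m + 3))"
    by (intro mult_mono) (auto simp: algebra_simps)
  also have "\<dots> = 2 ^ m * (2 * m + 3)\<^sup>2" by (simp add: power2_eq_square)
  also have "(2 * m + 3)\<^sup>2 \<le> 2 ^ (t + 12)"
    unfolding m_def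
  proof (induction t)
    case (Suc t)
    have "(2 * (2 * Suc t + 13) + 3)\<^sup>2 \<le> 2 * (2 * (2 * t + 13) + 3)\<^sup>2"
      by (simp add: power2_eq_square algebra_simps)
    also have "\<dots> \<le> 2 * 2 ^ (t + 12)" using Suc by simp
    also have "\<dots> = 2 ^ (Suc t + 12)" by (simp only: power_Suc add_Suc)
    finally show ?case .
  qed simp
  finally have le: "(2 * m + 1) * (2 ^ m * (2 * m + 1) + 2) \<le> 2 ^ m * 2 ^ (t + 12)" by simp
  have "2 ^ m * 2 ^ m = (4::nat) ^ m" by (simp flip: power_mult_distrib)
  also have "\<dots> \<le> (2 * m + 1) * (2 ^ m * (2 * m + 1) + 2) * card V"
    using card_vanishing_orders_ge[of m] by (simp add: V_def m)
  also have "\<dots> \<le> 2 ^ m * 2 ^ (t + 12) * card V" by (rule mult_right_mono[OF le]) simp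
  finally have "(2::nat) ^ m \<le> 2 ^ (t + 12) * card V" by simp
  also have "m = (t + 12) + Suc t" by (simp add: m_def)
  also have "(2::nat) ^ \<dots> = 2 ^ (t + 12) * (2 * 2 ^ t)"
    by (simp only: power_add[of _ "t + 12" "Suc t"] power_Suc)
  finally have cV: "2 * 2 ^ t \<le> card V" by simp
  define E where "E = {f\<in>V. even f}"
  define O' where "O' = {f\<in>V. odd f}"
  have "V = E \<union> O'" by (auto simp: E_def O'_def)
  moreover have "card (E \<union> O') = card E + card O'"
    using finV by (intro card_Un_disjoint) (auto simp: E_def O'_def)
  ultimately have "card V = card E + card O'" by simp
  then have "2 ^ t \<le> card E \<or> 2 ^ t \<le> card O'" using cV by linarith
  then obtain W where W: "W = E \<or> W = O'" "2 ^ t \<le> card W" by blast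
  then obtain F where F: "F \<subseteq> W" "card F = 2 ^ t" by (metis obtain_subset_with_card_n)
  have "f + 2 \<le> g" if "f \<in> F" "g \<in> F" "f < g" for f g
  proof -
    have "even (g - f)" using that F W by (auto simp: E_def O'_def)
    then show ?thesis using that by (cases "g - f = 1") auto
  qed
  moreover have "F \<subseteq> V" using F W by (auto simp: E_def O'_def)
  ultimately show ?thesis using F finite_subset[OF _ finV] unfolding V_def by blast
qed

section \<open>Exponential sums near zero\<close>

text \<open>The polynomial behind \<open>vanishing_orders\<close>, evaluated at
  \<open>exp x\<close>: its order of vanishing at 1 becomes the order at
  \<open>x = 0\<close>.\<close>

definition exp_diff :: "nat set \<Rightarrow> nat set \<Rightarrow> real \<Rightarrow> real" where
  "exp_diff \<Omega> \<Omega>' x = (\<Sum>b\<in>\<Omega>. exp (real b * x)) - (\<Sum>b\<in>\<Omega>'. exp (real b * x))"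

lemma exp_taylor_tendsto:
  "((\<lambda>x::real. (exp (c * x) - (\<Sum>i\<le>f. (c * x) ^ i / fact i)) / x ^ f) \<longlongrightarrow> 0) (at_right 0)"
proof (rule Lim_null_comparison)
  show "\<forall>\<^sub>F x in at_right 0. norm ((exp (c * x) - (\<Sum>i\<le>f. (c * x) ^ i / fact i)) / x ^ f)
      \<le> exp \<bar>c\<bar> * \<bar>c\<bar> ^ Suc f * x"
    using eventually_at_right_less[of "0::real"] eventually_at_right_real[OF zero_less_one]
  proof eventually_elim
    case (elim x)
    obtain t where t: "\<bar>t\<bar> \<le> \<bar>c * x\<bar>"
      "exp (c * x) = (\<Sum>i<Suc f. (c * x) ^ i / fact i) + exp t / fact (Suc f) * (c * x) ^ Suc f"
      using Maclaurin_exp_le[of "c * x" "Suc f"] by blast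
    have "\<bar>t\<bar> \<le> \<bar>c\<bar>"
      using t(1) elim mult_left_mono[of x 1 "\<bar>c\<bar>"] by (simp add: abs_mult)
    then have "exp t \<le> exp \<bar>c\<bar>" by simp
    moreover have "(1::real) \<le> fact (Suc f)" by (rule fact_ge_1)
    ultimately have "exp t / fact (Suc f) \<le> exp \<bar>c\<bar> / 1" by (intro frac_le) auto
    then have "exp t / fact (Suc f) * (\<bar>c\<bar> ^ Suc f * x) \<le> exp \<bar>c\<bar> * (\<bar>c\<bar> ^ Suc f * x)"
      using elim by (intro mult_right_mono) auto
    moreover have "norm ((exp (c * x) - (\<Sum>i\<le>f. (c * x) ^ i / fact i)) / x ^ f) =
        exp t / fact (Suc f) * (\<bar>c\<bar> ^ Suc f * x)"
      using elim by (simp add: t(2) lessThan_Suc_atMost abs_mult power_mult_distrib power_abs del: fact_Suc)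
    ultimately show ?case by (simp add: mult.assoc)
  qed
  show "((\<lambda>x. exp \<bar>c\<bar> * \<bar>c\<bar> ^ Suc f * x) \<longlongrightarrow> 0) (at_right 0)"
    by (auto intro!: tendsto_eq_intros)
qed

text \<open>The moments divided by factorials are the Taylor coefficients at 0; those below
  \<open>f\<close> cancel.\<close>

lemma exp_diff_tendsto:
  assumes "finite \<Omega>" "finite \<Omega>'" "\<forall>i<f. moment i \<Omega> = moment i \<Omega>'"
  shows "((\<lambda>x. exp_diff \<Omega> \<Omega>' x / x ^ f) \<longlongrightarrow>
    (real (moment f \<Omega>) - real (moment f \<Omega>')) / fact f) (at_right 0)"
proof -
  define E where "E b x = (exp (real b * x) - (\<Sum>i\<le>f. (real b * x) ^ i / fact i)) / x ^ f" for b x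
  define M where "M = (real (moment f \<Omega>) - real (moment f \<Omega>')) / fact f"
  have "((\<lambda>x. M + ((\<Sum>b\<in>\<Omega>. E b x) - (\<Sum>b\<in>\<Omega>'. E b x))) \<longlongrightarrow>
      M + ((\<Sum>b\<in>\<Omega>. 0) - (\<Sum>b\<in>\<Omega>'. 0))) (at_right 0)"
    unfolding E_def by (intro tendsto_intros exp_taylor_tendsto)
  moreover have "\<forall>\<^sub>F x in at_right 0. M + ((\<Sum>b\<in>\<Omega>. E b x) - (\<Sum>b\<in>\<Omega>'. E b x)) = exp_diff \<Omega> \<Omega>' x / x ^ f"
    using eventually_at_right_less[of "0::real"]
  proof eventually_elim
    case (elim x)
    have *: "(\<Sum>b\<in>\<Omega>. E b x) = (\<Sum>b\<in>\<Omega>. exp (real b * x)) / x ^ f -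
        (\<Sum>i\<le>f. real (moment i \<Omega>) * x ^ i / fact i) / x ^ f" for \<Omega>
    proof -
      have "(\<Sum>b\<in>\<Omega>. \<Sum>i\<le>f. (real b * x) ^ i / fact i) = (\<Sum>i\<le>f. real (moment i \<Omega>) * x ^ i / fact i)"
        by (subst sum.swap) (simp add: moment_def power_mult_distrib sum_distrib_right sum_divide_distrib)
      then show ?thesis
        by (simp add: E_def diff_divide_distrib sum_subtractf flip: sum_divide_distrib)
    qed
    have "(\<Sum>i\<le>f. real (moment i \<Omega>) * x ^ i / fact i) - (\<Sum>i\<le>f. real (moment i \<Omega>') * x ^ i / fact i) = M * x ^ f"
      using assms(3) by (simp add: M_def diff_divide_distrib left_diff_distrib flip: lessThan_Suc_atMost)
    then show ?case using elim unfolding * exp_diff_def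
      by (simp add: field_simps)
  qed
  ultimately show ?thesis unfolding M_def by (auto intro: Lim_transform_eventually)
qed

text \<open>The two sides have orders at least \<open>g\<close> and exactly \<open>f + 1\<close>.
  The gap of two thus leaves a spare factor \<open>x\<close> that beats every constant
  \<open>K\<close>.\<close>

lemma exp_diff_dominates:
  assumes "finite \<Omega>" "finite \<Omega>'" "\<forall>i<f. moment i \<Omega> = moment i \<Omega>'" "moment f \<Omega> \<noteq> moment f \<Omega>'"
    and "finite \<Psi>" "finite \<Psi>'" "\<forall>i<g. moment i \<Psi> = moment i \<Psi>'"
    and "f + 2 \<le> g" "K > 0"
  shows "\<forall>\<^sub>F x in at_right 0. K * \<bar>exp_diff \<Psi> \<Psi>' x\<bar> \<le> \<bar>exp_diff \<Omega> \<Omega>' x\<bar> * x"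
proof -
  define M where "M = \<bar>(real (moment f \<Omega>) - real (moment f \<Omega>')) / fact f\<bar>"
  define N where "N = \<bar>(real (moment g \<Psi>) - real (moment g \<Psi>')) / fact g\<bar>"
  have M: "M > 0" using assms by (simp add: M_def)
  have N: "N \<ge> 0" by (simp add: N_def)
  have "((\<lambda>x. \<bar>exp_diff \<Omega> \<Omega>' x / x ^ f\<bar>) \<longlongrightarrow> M) (at_right 0)"
    unfolding M_def by (intro tendsto_rabs exp_diff_tendsto assms)
  then have 1: "\<forall>\<^sub>F x in at_right 0. M / 2 < \<bar>exp_diff \<Omega> \<Omega>' x / x ^ f\<bar>"
    using M by (intro order_tendstoD(1)) auto
  have "((\<lambda>x. \<bar>exp_diff \<Psi> \<Psi>' x / x ^ g\<bar>) \<longlongrightarrow> N) (at_right 0)"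
    unfolding N_def by (intro tendsto_rabs exp_diff_tendsto assms)
  \<comment> \<open>\<open>N\<close> may be 0, so the strict upper bound uses
    \<open>N + 1\<close>.\<close>
  then have 2: "\<forall>\<^sub>F x in at_right 0. \<bar>exp_diff \<Psi> \<Psi>' x / x ^ g\<bar> < N + 1"
    by (intro order_tendstoD(2)) auto
  have "M / 2 / (K * (N + 1)) > 0" using M N assms by simp
  from eventually_at_right_real[OF this]
  show ?thesis using 1 2 eventually_at_right_real[OF zero_less_one]
  proof eventually_elim
    case (elim x)
    then have x: "0 < x" "x < 1" by auto
    have pos: "x ^ g > 0" "x ^ f > 0" using x by auto
    have "x * (K * (N + 1)) \<le> M / 2" using elim N assms
        pos_less_divide_eq[of "K * (N + 1)" x "M / 2"] by (simp add: less_imp_le)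
    then have xs: "K * (N + 1) * x ^ 2 \<le> M / 2 * x"
      using mult_right_mono[of "x * (K * (N + 1))" "M / 2" x] x by (simp add: power2_eq_square mult_ac)
    have "\<bar>exp_diff \<Psi> \<Psi>' x\<bar> \<le> (N + 1) * x ^ g"
      using elim pos by (simp add: abs_divide divide_less_eq)
    also have "\<dots> \<le> (N + 1) * x ^ (f + 2)"
      using x N assms by (intro mult_left_mono power_decreasing) auto
    finally have "K * \<bar>exp_diff \<Psi> \<Psi>' x\<bar> \<le> K * ((N + 1) * x ^ (f + 2))"
      using assms by (intro mult_left_mono) auto
    also have "\<dots> = (K * (N + 1) * x ^ 2) * x ^ f" by (simp add: power_add power2_eq_square mult_ac)
    also have "\<dots> \<le> (M / 2 * x) * x ^ f" using xs pos by (intro mult_right_mono) auto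
    also have "\<dots> = (M / 2 * x ^ f) * x" by simp
    also have "\<dots> \<le> \<bar>exp_diff \<Omega> \<Omega>' x\<bar> * x"
      using elim x pos by (intro mult_right_mono) (auto simp: abs_divide less_divide_eq)
    finally show ?case .
  qed
qed

section \<open>Sums of dilates\<close>

text \<open>At the least index \<open>f\<close> where two choices differ, the difference has size at
  least \<open>\<bar>u f\<bar> * d * x\<close>; by \<open>dom\<close>, all later indices together
  contribute at most half of that.\<close>

lemma inj_on_weighted_sum:
  fixes u :: "nat \<Rightarrow> real"
  assumes F: "finite F" and S: "S \<subseteq> {x..2 * x}" and x: "x > 0" and d: "d > 0"
    and sep: "\<And>s s'. s \<in> S \<Longrightarrow> s' \<in> S \<Longrightarrow> s < s' \<Longrightarrow> s + d * x \<le> s'"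
    and nz: "\<And>f. f \<in> F \<Longrightarrow> u f \<noteq> 0"
    and dom: "\<And>f g. f \<in> F \<Longrightarrow> g \<in> F \<Longrightarrow> f < g \<Longrightarrow> 2 * card F * \<bar>u g\<bar> \<le> \<bar>u f\<bar> * d"
  shows "inj_on (\<lambda>s. \<Sum>f\<in>F. u f * s f) (PiE F (\<lambda>_. S))"
proof (rule inj_onI, rule ccontr)
  fix s t assume st: "s \<in> PiE F (\<lambda>_. S)" "t \<in> PiE F (\<lambda>_. S)"
    and eq: "(\<Sum>f\<in>F. u f * s f) = (\<Sum>f\<in>F. u f * t f)" and ne: "s \<noteq> t"
  define F' where "F' = {f\<in>F. s f \<noteq> t f}"
  have "F' \<noteq> {}" using ne PiE_ext[OF st] by (auto simp: F'_def)
  moreover have "finite F'" using F by (simp add: F'_def)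
  ultimately obtain f where f: "f \<in> F'" "\<And>g. g \<in> F' \<Longrightarrow> f \<le> g"
    by (metis Min_in Min_le)
  have fF: "f \<in> F" "s f \<noteq> t f" using f by (auto simp: F'_def)
  have cF: "card F > 0" using F fF by (auto simp: card_gt_0_iff)
  have "0 = (\<Sum>g\<in>F. u g * (s g - t g))" using eq by (simp add: right_diff_distrib sum_subtractf)
  also have "\<dots> = u f * (s f - t f) + (\<Sum>g\<in>F - {f}. u g * (s g - t g))"
    using F fF by (simp add: sum.remove)
  finally have "\<bar>u f * (s f - t f)\<bar> = \<bar>\<Sum>g\<in>F - {f}. u g * (s g - t g)\<bar>" by linarith
  also have "\<dots> \<le> (\<Sum>g\<in>F - {f}. \<bar>u g * (s g - t g)\<bar>)" by (rule sum_abs)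
  also have "\<dots> \<le> (\<Sum>g\<in>F - {f}. \<bar>u f\<bar> * d * x / (2 * card F))"
  proof (rule sum_mono)
    fix g assume g: "g \<in> F - {f}"
    show "\<bar>u g * (s g - t g)\<bar> \<le> \<bar>u f\<bar> * d * x / (2 * card F)"
    proof (cases "g \<in> F'")
      case True
      then have "f < g" using f(2)[of g] g by auto
      then have "2 * card F * \<bar>u g\<bar> \<le> \<bar>u f\<bar> * d" using dom fF g by auto
      then have 1: "\<bar>u g\<bar> \<le> \<bar>u f\<bar> * d / (2 * card F)" using cF by (simp add: field_simps)
      have "s g \<in> S" "t g \<in> S" using st g by auto
      then have "s g \<in> {x..2 * x}" "t g \<in> {x..2 * x}" using S by blast+
      then have "\<bar>s g - t g\<bar> \<le> x" by (auto simp: abs_le_iff)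
      with 1 have "\<bar>u g\<bar> * \<bar>s g - t g\<bar> \<le> \<bar>u f\<bar> * d / (2 * card F) * x"
        by (intro mult_mono) auto
      then show ?thesis by (simp add: abs_mult)
    qed (use g d x in \<open>auto simp: F'_def\<close>)
  qed
  also have "\<dots> \<le> (\<Sum>g\<in>F. \<bar>u f\<bar> * d * x / (2 * card F))"
    using F d x by (intro sum_mono2) auto
  also have "\<dots> = \<bar>u f\<bar> * d * x / 2" using cF by simp
  finally have le: "\<bar>u f\<bar> * \<bar>s f - t f\<bar> \<le> \<bar>u f\<bar> * d * x / 2" by (simp add: abs_mult)
  have "s f \<in> S" "t f \<in> S" using st fF by auto
  then have "d * x \<le> \<bar>s f - t f\<bar>"
    using sep[of "s f" "t f"] sep[of "t f" "s f"] fF by (cases "s f < t f") auto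
  then have "\<bar>u f\<bar> * (d * x) \<le> \<bar>u f\<bar> * \<bar>s f - t f\<bar>" by (rule mult_left_mono) simp
  moreover have "\<bar>u f\<bar> * d * x > 0" using nz fF d x by simp
  ultimately show False using le by (simp add: mult.assoc)
qed

lemma sum_in_set_sum:
  assumes "finite I" "\<And>i. i \<in> I \<Longrightarrow> f i \<in> D i"
  shows "(\<Sum>i\<in>I. f i) \<in> (\<Sum>i\<in>I. D i)"
  using assms by (auto simp: set_sum_alt)

text \<open>Separating the positive from the negative exponentials in \<open>u f\<close> writes each
  of the distinct sums as a difference of elements of the two sums of dilates; a difference set has
  at most as many elements as there are pairs.\<close>

lemma card_power_le_card_sum_dilates:
  fixes A S :: "real set" and d :: real and \<Omega> \<Omega>' :: "nat \<Rightarrow> nat set"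
  defines "u f \<equiv> exp_diff (\<Omega> f) (\<Omega>' f) d"
  assumes F: "finite F" "\<And>f. f \<in> F \<Longrightarrow> finite (\<Omega> f)" "\<And>f. f \<in> F \<Longrightarrow> finite (\<Omega>' f)"
    and A: "finite A" "S \<subseteq> A"
    and inj: "inj_on (\<lambda>s. \<Sum>f\<in>F. u f * s f) (PiE F (\<lambda>_. S))"
  shows "card S ^ card F \<le>
    card (\<Sum>i\<in>Sigma F \<Omega>. (*) (exp (real (snd i) * d)) ` A) *
    card (\<Sum>i\<in>Sigma F \<Omega>'. (*) (exp (real (snd i) * d)) ` A)"
proof -
  define D where "D \<Omega> = (\<Sum>i\<in>Sigma F \<Omega>. (*) (exp (real (snd i) * d)) ` A)" for \<Omega> :: "nat \<Rightarrow> nat set"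
  have finD: "finite (D \<Omega>)" "finite (D \<Omega>')"
    unfolding D_def using F A by (auto intro!: finite_set_sum)
  have inD: "(\<Sum>f\<in>F. (\<Sum>b\<in>\<Omega> f. exp (real b * d)) * s f) \<in> D \<Omega>"
    if s: "s \<in> PiE F (\<lambda>_. S)" and fin: "\<forall>f\<in>F. finite (\<Omega> f)" for s \<Omega>
  proof -
    have "(\<Sum>f\<in>F. (\<Sum>b\<in>\<Omega> f. exp (real b * d)) * s f) =
        (\<Sum>i\<in>Sigma F \<Omega>. exp (real (snd i) * d) * s (fst i))"
      using F fin by (simp add: sum_distrib_right sum.Sigma case_prod_beta)
    also have "\<dots> \<in> D \<Omega>" unfolding D_def
    proof (rule sum_in_set_sum)
      show "finite (Sigma F \<Omega>)" using F fin by auto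
      show "exp (real (snd i) * d) * s (fst i) \<in> (*) (exp (real (snd i) * d)) ` A"
        if "i \<in> Sigma F \<Omega>" for i using that s A by auto
    qed
    finally show ?thesis .
  qed
  have "card S ^ card F = card (PiE F (\<lambda>_. S))" using F by (simp add: card_PiE)
  also have "\<dots> = card ((\<lambda>s. \<Sum>f\<in>F. u f * s f) ` PiE F (\<lambda>_. S))"
    using inj by (simp add: card_image)
  also have "\<dots> \<le> card ((\<lambda>(a, b). a - b) ` (D \<Omega> \<times> D \<Omega>'))"
  proof (intro card_mono subsetI)
    fix y assume "y \<in> (\<lambda>s. \<Sum>f\<in>F. u f * s f) ` PiE F (\<lambda>_. S)"
    then obtain s where s: "s \<in> PiE F (\<lambda>_. S)" "y = (\<Sum>f\<in>F. u f * s f)" by blast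
    have "y = (\<Sum>f\<in>F. (\<Sum>b\<in>\<Omega> f. exp (real b * d)) * s f) - (\<Sum>f\<in>F. (\<Sum>b\<in>\<Omega>' f. exp (real b * d)) * s f)"
      by (simp add: s u_def exp_diff_def left_diff_distrib sum_subtractf)
    then show "y \<in> (\<lambda>(a, b). a - b) ` (D \<Omega> \<times> D \<Omega>')"
      using inD[OF s(1), of \<Omega>] inD[OF s(1), of \<Omega>'] F by force
  qed (use finD in auto)
  also have "\<dots> \<le> card (D \<Omega> \<times> D \<Omega>')" using finD by (intro card_image_le) auto
  finally show ?thesis by (simp add: card_cartesian_product D_def)
qed

text \<open>The sumset \<open>j(A \<inter> cA)\<close> is nearly all of \<open>jA\<close> and lies in \<open>c(jA)\<close>, hence it absorbs a further summand
  \<open>cA\<close> as cheaply as \<open>jA\<close> absorbs \<open>A\<close>. The sum over \<open>b \<in> T\<close> of such sets absorbs all the dilates.\<close>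

lemma card_sum_dilates_le_hfold_sumset:
  fixes A :: "real set" and c :: "'b \<Rightarrow> real" and K1 K2 :: real
  assumes A: "finite A" "A \<noteq> {}" and T: "finite T" "\<And>b. b \<in> T \<Longrightarrow> c b \<noteq> 0"
    and K: "K1 \<ge> 0" "K2 \<ge> 0"
    and stable: "\<And>b. b \<in> T \<Longrightarrow>
      real (card (hfold_sumset j A)) \<le> K1 * card (hfold_sumset j (A \<inter> (*) (c b) ` A))"
    and growth: "real (card (hfold_sumset (Suc j) A)) \<le> K2 * card (hfold_sumset j A)"
    and I: "finite I" "\<beta> ` I \<subseteq> T"
  shows "real (card (\<Sum>i\<in>I. (*) (c (\<beta> i)) ` A)) \<le>
    (K2 * K1) ^ card I * card (hfold_sumset (card T * j) A)"
proof -
  define D where "D b = (*) (c b) ` A" for b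
  have D: "finite (D b)" for b using A by (simp add: D_def)
  have "\<exists>U. U \<subseteq> hfold_sumset j A \<and> U \<noteq> {} \<and>
    (\<forall>C. finite C \<longrightarrow> real (card (C + U + D b)) \<le> (K2 * K1) * card (C + U))" if b: "b \<in> T" for b
  proof -
    define X where "X = hfold_sumset j (A \<inter> D b)"
    have XA: "X \<subseteq> hfold_sumset j A" and XD: "X \<subseteq> hfold_sumset j (D b)"
      by (simp_all add: X_def hfold_sumset_mono)
    have finX: "finite X" using XA A by (metis finite_hfold_sumset finite_subset)
    have "0 < real (card (hfold_sumset j A))"
      using A by (simp add: card_gt_0_iff hfold_sumset_nonempty)
    then have X: "X \<noteq> {}" using stable[OF b] by (auto simp: X_def D_def)
    have "X + D b \<subseteq> hfold_sumset (Suc j) (D b)"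
      unfolding hfold_sumset_Suc using XD by (intro set_plus_mono2) auto
    then have "card (X + D b) \<le> card (hfold_sumset (Suc j) (D b))"
      using D by (intro card_mono) auto
    also have "\<dots> = card (hfold_sumset (Suc j) A)"
      unfolding D_def hfold_sumset_image_mult using T b
      by (intro card_image) (auto simp: inj_on_def)
    finally have "real (card (X + D b)) \<le> card (hfold_sumset (Suc j) A)" by simp
    also have "\<dots> \<le> K2 * card (hfold_sumset j A)" by (rule growth)
    also have "\<dots> \<le> K2 * (K1 * card X)"
      unfolding X_def D_def using K by (intro mult_left_mono stable b)
    finally have "real (card (X + D b)) \<le> K2 * K1 * card X" by (simp add: mult.assoc)
    from petridis[OF finX X D this] show ?thesis using XA by (meson order.trans)
  qed
  then obtain U where U: "\<And>b. b \<in> T \<Longrightarrow> U b \<subseteq> hfold_sumset j A" "\<And>b. b \<in> T \<Longrightarrow> U b \<noteq> {}"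
    "\<And>b C. b \<in> T \<Longrightarrow> finite C \<Longrightarrow> real (card (C + U b + D b)) \<le> (K2 * K1) * card (C + U b)"
    by metis
  have finU: "finite (U b)" if "b \<in> T" for b
    using U(1)[OF that] A by (metis finite_hfold_sumset finite_subset)
  have "real (card (\<Sum>i\<in>I. D (\<beta> i))) \<le> (K2 * K1) ^ card I * card (\<Sum>b\<in>T. U b)"
    using K by (intro card_sum_dilates_le I T finU D U) auto
  also have "(\<Sum>b\<in>T. U b) \<subseteq> (\<Sum>b\<in>T. hfold_sumset j A)"
    by (intro set_sum_subset T U)
  then have "card (\<Sum>b\<in>T. U b) \<le> card (hfold_sumset (card T * j) A)"
    using A T by (intro card_mono) (simp_all add: set_sum_hfold_sumset)
  then have "(K2 * K1) ^ card I * card (\<Sum>b\<in>T. U b) \<le> (K2 * K1) ^ card I * card (hfold_sumset (card T * j) A)"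
    using K by (intro mult_left_mono) auto
  finally show ?thesis by (simp add: D_def)
qed

text \<open>Otherwise the sizes, starting from 1 at \<open>j = 0\<close>, would multiply up to more
  than \<open>r ^ J\<close>.\<close>

lemma ex_slow_growth:
  fixes A :: "real set" and r :: real
  assumes "A \<noteq> {}" "r \<ge> 0" "card (hfold_sumset J A) \<le> r ^ J" "J > 0"
  shows "\<exists>j<J. real (card (hfold_sumset (Suc j) A)) \<le> r * card (hfold_sumset j A)"
proof (rule ccontr)
  assume "\<not> ?thesis"
  then have *: "r * card (hfold_sumset j A) < card (hfold_sumset (Suc j) A)" if "j < J" for j
    using that by force
  have ge: "r ^ j \<le> card (hfold_sumset j A)" if "j < J" for j
    using that
  proof (induction j)
    case (Suc j)
    then have "r * r ^ j \<le> r * card (hfold_sumset j A)" using assms by (intro mult_left_mono) auto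
    with *[of j] Suc show ?case by simp
  qed simp
  obtain j where j: "J = Suc j" using assms by (cases J) auto
  have "r * r ^ j \<le> r * card (hfold_sumset j A)" using ge[of j] j assms by (intro mult_left_mono) auto
  with *[of j] j assms show False by simp
qed

text \<open>In a lacunary set each element exceeds the sum of any distinct smaller ones, so the
  largest element of the symmetric difference decides which of two subset sums is bigger. Hence sums
  over distinct \<open>p\<close>-subsets differ.\<close>

lemma card_hfold_sumset_lacunary:
  fixes A S :: "real set"
  assumes A: "finite A" "S \<subseteq> A" "S \<subseteq> {0<..}"
    and lac: "\<And>s s'. s \<in> S \<Longrightarrow> s' \<in> S \<Longrightarrow> s < s' \<Longrightarrow> 2 * s \<le> s'"
  shows "card S choose p \<le> card (hfold_sumset p A)"
proof -
  have finS: "finite S" using A finite_subset by blast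
  have small: "\<Sum>X < m" if "finite X" "X \<subseteq> S" "m \<in> S" "\<forall>x\<in>X. x < m" for X m
    using that
  proof (induction X arbitrary: m rule: finite_linorder_max_induct)
    case (insert b X)
    then have "\<Sum>X < b" by auto
    moreover have "2 * b \<le> m" using insert lac by auto
    moreover have "\<Sum>(insert b X) = b + \<Sum>X" using insert by (intro sum.insert) auto
    ultimately show ?case by linarith
  qed (use A in auto)
  have less: "\<Sum>Y < \<Sum>X" if XY: "X \<subseteq> S" "Y \<subseteq> S" and m: "m \<in> X" "m \<notin> Y" "\<forall>y\<in>Y - X. y < m" for X Y m
  proof -
    have fin: "finite X" "finite Y" using XY finS finite_subset by blast+
    have "\<Sum>Y = \<Sum>(Y \<inter> X) + \<Sum>(Y - X)" using fin by (simp add: sum.Int_Diff)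
    also have "\<Sum>(Y - X) < m" using fin XY m by (intro small) auto
    also have "m \<le> \<Sum>(X - Y)" using fin m XY A by (intro member_le_sum) (auto intro: less_imp_le)
    also have "\<Sum>(Y \<inter> X) + \<Sum>(X - Y) = \<Sum>X" using fin by (simp add: sum.Int_Diff[of X _ Y] Int_commute)
    finally show ?thesis by simp
  qed
  have inj: "inj_on (\<lambda>X. \<Sum>X) {X. X \<subseteq> S \<and> card X = p}"
  proof (rule inj_onI, rule ccontr)
    fix X Y assume XY: "X \<in> {X. X \<subseteq> S \<and> card X = p}" "Y \<in> {X. X \<subseteq> S \<and> card X = p}"
      and eq: "\<Sum>X = \<Sum>Y" and ne: "X \<noteq> Y"
    define E where "E = (X - Y) \<union> (Y - X)"
    have E: "E \<noteq> {}" "finite E" using ne XY finS by (auto simp: E_def intro: finite_subset)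
    define m where "m = Max E"
    have m: "m \<in> E" "\<And>e. e \<in> E \<Longrightarrow> e \<le> m" using E by (auto simp: m_def)
    show False
    proof (cases "m \<in> X")
      case True
      then show False using less[of X Y m] XY m eq by (force simp: E_def order.strict_iff_order)
    next
      case False
      then show False using less[of Y X m] XY m eq by (force simp: E_def order.strict_iff_order)
    qed
  qed
  have "(\<lambda>X. \<Sum>X) ` {X. X \<subseteq> S \<and> card X = p} \<subseteq> hfold_sumset p A"
  proof safe
    fix X assume X: "X \<subseteq> S" "p = card X"
    then obtain f where f: "bij_betw f {..<p} X"
      using ex_bij_betw_nat_finite[of X] finS finite_subset by (metis lessThan_atLeast0)
    then have "\<Sum>X = (\<Sum>i<p. f i)" using sum.reindex_bij_betw[OF f, of "\<lambda>x. x"] by simp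
    moreover have "\<forall>i<p. f i \<in> A" using f X A unfolding bij_betw_def by blast
    ultimately show "\<Sum>X \<in> hfold_sumset (card X) A" using X by (auto simp: hfold_sumset_def)
  qed
  then have "card ((\<lambda>X. \<Sum>X) ` {X. X \<subseteq> S \<and> card X = p}) \<le> card (hfold_sumset p A)"
    using A by (intro card_mono) auto
  then show ?thesis using inj finS by (simp add: card_image n_subsets)
qed

lemma eventually_powr_ge:
  fixes a c :: real
  assumes "a > 0"
  shows "\<forall>\<^sub>F n in at_top. c \<le> n powr a"
  using eventually_ge_at_top[of "max 1 c powr (1 / a)"]
proof eventually_elim
  case (elim n)
  have "c \<le> (max 1 c powr (1 / a)) powr a" using assms by (simp add: powr_powr)
  also have "\<dots> \<le> n powr a" using elim assms by (intro powr_mono2) auto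
  finally show ?case .
qed

text \<open>\<open>F\<close> is finite, so a single threshold serves all orders and all pairs of
  orders.\<close>

lemma eventually_exp_diff_lacunary:
  assumes F: "finite F" and sp: "\<And>f g. f \<in> F \<Longrightarrow> g \<in> F \<Longrightarrow> f < g \<Longrightarrow> f + 2 \<le> g"
    and fin: "\<And>f. f \<in> F \<Longrightarrow> finite (\<Omega> f)" "\<And>f. f \<in> F \<Longrightarrow> finite (\<Omega>' f)"
    and mom: "\<And>f i. f \<in> F \<Longrightarrow> i < f \<Longrightarrow> moment i (\<Omega> f) = moment i (\<Omega>' f)"
    and ne: "\<And>f. f \<in> F \<Longrightarrow> moment f (\<Omega> f) \<noteq> moment f (\<Omega>' f)"
    and K: "K > 0"
  shows "\<forall>\<^sub>F x in at_right 0. (\<forall>f\<in>F. exp_diff (\<Omega> f) (\<Omega>' f) x \<noteq> 0) \<and>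
    (\<forall>f\<in>F. \<forall>g\<in>F. f < g \<longrightarrow>
      K * \<bar>exp_diff (\<Omega> g) (\<Omega>' g) x\<bar> \<le> \<bar>exp_diff (\<Omega> f) (\<Omega>' f) x\<bar> * x)"
proof (intro eventually_conj eventually_ball_finite F ballI)
  fix f assume f: "f \<in> F"
  have "((\<lambda>x. exp_diff (\<Omega> f) (\<Omega>' f) x / x ^ f) \<longlongrightarrow>
      (real (moment f (\<Omega> f)) - real (moment f (\<Omega>' f))) / fact f) (at_right 0)"
    using f fin mom by (intro exp_diff_tendsto) auto
  moreover have "(real (moment f (\<Omega> f)) - real (moment f (\<Omega>' f))) / fact f \<noteq> 0"
    using ne[OF f] by simp
  ultimately have "\<forall>\<^sub>F x in at_right 0. exp_diff (\<Omega> f) (\<Omega>' f) x / x ^ f \<noteq> 0"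
    by (rule tendsto_imp_eventually_ne)
  then show "\<forall>\<^sub>F x in at_right 0. exp_diff (\<Omega> f) (\<Omega>' f) x \<noteq> 0"
    by eventually_elim auto
next
  fix f g assume fg: "f \<in> F" "g \<in> F"
  show "\<forall>\<^sub>F x in at_right 0. f < g \<longrightarrow>
      K * \<bar>exp_diff (\<Omega> g) (\<Omega>' g) x\<bar> \<le> \<bar>exp_diff (\<Omega> f) (\<Omega>' f) x\<bar> * x"
  proof (cases "f < g")
    case True
    show ?thesis
      using exp_diff_dominates[of "\<Omega> f" "\<Omega>' f" f "\<Omega> g" "\<Omega>' g" g K]
        fg fin mom ne sp[OF fg True] K True by simp
  qed simp
qed

section \<open>The bound for sets of positive numbers\<close>

text \<open>In logarithmic coordinates, \<open>d\<close> is the least popular difference. A window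
  of length \<open>d\<close> with more than \<open>n powr \<gamma>\<close> points would contain a
  smaller popular difference, so windows are sparse and a large \<open>d\<close>-separated set
  survives.\<close>

lemma ex_popular_dilates:
  fixes A :: "real set" and n \<alpha> :: real
  assumes A: "finite A" "A \<subseteq> {0<..}" and n: "n > 1" and \<alpha>: "\<alpha> > 0" "2 \<le> n powr \<alpha>"
    and cA: "n powr (1 - \<alpha>) \<le> card A" and cAA: "card (A * A) \<le> n powr (1 + \<alpha>)"
    and small: "real (2 * (B + 1)\<^sup>2 + 2) * \<alpha> \<le> 1 / 8"
  defines "\<gamma> \<equiv> real (2 * (B + 1)\<^sup>2 + 1) * \<alpha>"
  shows "\<exists>d>0. (\<forall>b\<le>B. n powr (1 - real (2 * (B + 1)\<^sup>2 + 2) * \<alpha>) \<le>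
        card (A \<inter> (*) (exp (real b * d)) ` A)) \<and>
     (\<exists>S\<subseteq>ln ` A. (\<forall>s\<in>S. \<forall>s'\<in>S. s < s' \<longrightarrow> s + d \<le> s') \<and> n powr (7/8) \<le> card S)"
proof -
  define L where "L = ln ` A"
  define E where "E = (B + 1)\<^sup>2"
  have \<gamma>: "\<gamma> = (2 * real E + 1) * \<alpha>" "\<gamma> + \<alpha> \<le> 1 / 8"
    "real (2 * (B + 1)\<^sup>2 + 2) * \<alpha> = \<gamma> + \<alpha>"
    using small by (simp_all add: \<gamma>_def E_def algebra_simps)
  have "\<gamma> \<ge> 0" using \<alpha> by (simp add: \<gamma>_def)
  have inj: "inj_on ln A"
    using A(2) by (intro inj_onI) (metis greaterThan_iff ln_inj_iff subsetD)
  have finL: "finite L" using A by (simp add: L_def)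
  have cL: "card L = card A" using inj by (simp add: L_def card_image)
  have neL: "L \<noteq> {}" using cA n cL by (auto simp: powr_gt_zero)
  have LL: "L + L = ln ` (A * A)"
  proof -
    have "ln x + ln y = ln (x * y)" if "x \<in> A" "y \<in> A" for x y
      using that A by (auto simp: ln_mult)
    then show ?thesis by (fastforce simp: L_def set_plus_def set_times_def image_iff)
  qed
  \<comment> \<open>One \<open>\<alpha>\<close> comes from the size of the product set, the other
    from the density of \<open>A\<close>. In \<open>\<gamma>\<close> a further
    \<open>\<alpha>\<close> absorbs the factor 2 in front of \<open>K ^ E\<close>.\<close>
  define K where "K = n powr (2 * \<alpha>)"
  have "real (card (L + L)) \<le> card (A * A)"
    unfolding LL using A by (simp add: card_image_le finite_set_times)
  also have "\<dots> \<le> n powr (1 + \<alpha>)" by (rule cAA)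
  also have "\<dots> = K * n powr (1 - \<alpha>)" by (simp add: K_def add.commute flip: powr_add)
  also have "\<dots> \<le> K * card L" using cA cL by (intro mult_left_mono) (auto simp: K_def)
  finally have K: "real (card (L + L)) \<le> K * card L" .
  have KE: "2 * K ^ E \<le> n powr \<gamma>"
  proof -
    have "2 * K ^ E \<le> n powr \<alpha> * K ^ E" using \<alpha> by (intro mult_right_mono) (auto simp: K_def)
    also have "\<dots> = n powr \<gamma>"
      using n by (simp add: K_def \<gamma>(1) powr_power algebra_simps flip: powr_add)
    finally show ?thesis .
  qed
  define good where "good d \<longleftrightarrow> (\<forall>b\<le>B. real (card L) \<le> n powr \<gamma> * card (L \<inter> (+) (real b * d) ` L))" for d
  have window: "\<exists>l\<in>W. \<exists>l'\<in>W. l < l' \<and> good (l' - l)" if "W \<subseteq> L" "n powr \<gamma> \<le> card W" for W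
  proof -
    have "2 * K ^ ((B + 1)\<^sup>2) \<le> card W" using KE that by (simp add: E_def)
    from ex_popular_progression[OF finL neL K that(1) this]
    obtain l l' where l: "l \<in> W" "l' \<in> W" "l < l'"
      "\<And>b. b \<le> B \<Longrightarrow> real (card L) \<le> 2 * K ^ E * card (L \<inter> (+) (real b * (l' - l)) ` L)"
      unfolding E_def by blast
    have "2 * K ^ E * real (card X) \<le> n powr \<gamma> * card X" for X :: "real set"
      using KE by (rule mult_right_mono) simp
    then have "good (l' - l)" unfolding good_def using l(4) by (meson order.trans)
    then show ?thesis using l by blast
  qed
  \<comment> \<open>Restricting to differences of \<open>L\<close> makes the set finite, so that a
    least element exists.\<close>
  define G where "G = {d. 0 < d \<and> good d} \<inter> (\<lambda>(l, l'). l' - l) ` (L \<times> L)"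
  have inG: "l' - l \<in> G" if "l \<in> L" "l' \<in> L" "l < l'" "good (l' - l)" for l l'
    using that by (auto simp: G_def intro!: image_eqI[of _ _ "(l, l')"])
  have "n powr \<gamma> \<le> n powr (1 - \<alpha>)" using \<gamma> n by (intro powr_mono) auto
  then have "n powr \<gamma> \<le> card L" using cA cL by simp
  from window[OF order.refl this] have "G \<noteq> {}" using inG by blast
  moreover have "finite G" using finL by (simp add: G_def)
  ultimately obtain d where d: "d \<in> G" "\<And>e. e \<in> G \<Longrightarrow> d \<le> e" by (metis Min_in Min_le)
  have dpos: "d > 0" and gd: "good d" using d by (auto simp: G_def)
  have "real (card (L \<inter> {x..<x + d})) \<le> n powr \<gamma>" for x
  proof (rule ccontr)
    assume "\<not> ?thesis"
    then obtain l l' where l: "l \<in> L \<inter> {x..<x + d}" "l' \<in> L \<inter> {x..<x + d}" "l < l'" "good (l' - l)"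
      using window[of "L \<inter> {x..<x + d}"] by force
    then have "l' - l \<in> G" by (intro inG) auto
    from d(2)[OF this] l show False by auto
  qed
  from ex_separated_subset[OF finL this dpos] obtain S where
    S: "S \<subseteq> L" "\<forall>s\<in>S. \<forall>s'\<in>S. s < s' \<longrightarrow> s + d \<le> s'" "real (card L) \<le> n powr \<gamma> * card S"
    by blast
  have "n powr \<gamma> * n powr (7/8) \<le> n powr (1 - \<alpha>)"
    unfolding powr_add[symmetric] using \<gamma> n by (intro powr_mono) auto
  also have "\<dots> \<le> n powr \<gamma> * card S" using cA cL S by simp
  finally have cS: "n powr (7/8) \<le> card S" using n by simp
  have "n powr (1 - real (2 * (B + 1)\<^sup>2 + 2) * \<alpha>) \<le> card (A \<inter> (*) (exp (real b * d)) ` A)"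
    if b: "b \<le> B" for b
  proof -
    have "L \<inter> (+) (real b * d) ` L \<subseteq> ln ` (A \<inter> (*) (exp (real b * d)) ` A)"
    proof
      fix y assume "y \<in> L \<inter> (+) (real b * d) ` L"
      then obtain x z where xz: "x \<in> A" "z \<in> A" "y = ln x" "ln x = real b * d + ln z"
        by (auto simp: L_def)
      have pos: "x > 0" "z > 0" using xz A by auto
      have "x = exp (real b * d + ln z)" using xz(4) pos by (metis exp_ln)
      also have "\<dots> = exp (real b * d) * z" using pos by (simp add: exp_add)
      finally show "y \<in> ln ` (A \<inter> (*) (exp (real b * d)) ` A)" using xz by blast
    qed
    then have "card (L \<inter> (+) (real b * d) ` L) \<le> card (ln ` (A \<inter> (*) (exp (real b * d)) ` A))"
      using A by (intro card_mono) auto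
    also have "\<dots> \<le> card (A \<inter> (*) (exp (real b * d)) ` A)" using A by (intro card_image_le) auto
    finally have le: "card (L \<inter> (+) (real b * d) ` L) \<le> card (A \<inter> (*) (exp (real b * d)) ` A)" .
    have "n powr \<gamma> * n powr (1 - (\<gamma> + \<alpha>)) = n powr (1 - \<alpha>)" by (simp flip: powr_add)
    also have "\<dots> \<le> n powr \<gamma> * card (L \<inter> (+) (real b * d) ` L)"
      using gd b cA cL by (force simp: good_def)
    also have "\<dots> \<le> n powr \<gamma> * card (A \<inter> (*) (exp (real b * d)) ` A)"
      using le by (intro mult_left_mono) auto
    finally show ?thesis using n unfolding \<gamma>(3) by simp
  qed
  then show ?thesis using dpos S cS unfolding L_def by blast
qed

text \<open>Argue by contradiction from \<open>card (hfold_sumset h A) < n powr q\<close>. This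
  bounds all the sumsets involved, since \<open>h\<close> covers the \<open>(B + 1) * j\<close>
  summands, \<open>j < J\<close>, that the sums of dilates produce.\<close>

lemma card_hfold_sumset_positive:
  fixes F :: "nat set" and q p B J h r :: nat
  assumes F: "finite F" "card F = p" "F \<subseteq> vanishing_orders B"
    and sp: "\<And>f g. f \<in> F \<Longrightarrow> g \<in> F \<Longrightarrow> f < g \<Longrightarrow> f + 2 \<le> g"
    and q: "q \<ge> 1" and p: "p = 16 * q" and r: "r = p * (B + 1)" and J: "J = 2 * r * q"
    and h: "(B + 1) * J \<le> h"
  shows "\<exists>\<epsilon>>0. \<forall>\<^sub>F n in at_top. \<forall>A::real set. finite A \<and> A \<subseteq> {0<..} \<and>
     n powr (1 - \<epsilon>) \<le> real (card A) \<and> real (card (A * A)) \<le> n powr (1 + \<epsilon>) \<longrightarrow>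
     n powr q \<le> card (hfold_sumset h A)"
proof -
  \<comment> \<open>\<open>C * \<alpha>\<close> is the density loss of the popular intersections;
    \<open>\<delta>\<close> is half of the cost \<open>1 / r\<close> allowed per dilate;
    \<open>M\<close> makes \<open>M * \<delta>\<close> exceed \<open>Suc J * q\<close>;
    \<open>\<epsilon>\<close> keeps \<open>C * \<alpha>\<close> at most \<open>1 / 8\<close> after
    \<open>M\<close> rounds.\<close>
  define C where "C = real (2 * (B + 1)\<^sup>2 + 2)"
  define \<delta> where "\<delta> = 1 / (2 * real r)"
  define M where "M = 2 * r * (Suc J * q) + 1"
  define \<epsilon> where "\<epsilon> = 1 / (8 * C ^ Suc M)"
  have C: "C \<ge> 1" by (simp add: C_def)
  have r0: "r > 0" using r p q by simp
  have J0: "J > 0" using J r0 q by simp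
  have \<epsilon>: "\<epsilon> > 0" using C by (simp add: \<epsilon>_def)
  have \<delta>: "\<delta> > 0" using r0 by (simp add: \<delta>_def)
  have M: "real M * \<delta> > real (Suc J) * real q"
  proof -
    have "real M * \<delta> = real (Suc J) * real q + \<delta>"
      using r0 by (simp add: M_def \<delta>_def field_simps)
    then show ?thesis using \<delta> by simp
  qed
  have "\<forall>f\<in>F. \<exists>\<Omega> \<Omega>'. \<Omega> \<subseteq> {..B} \<and> \<Omega>' \<subseteq> {..B} \<and>
     (\<forall>i<f. moment i \<Omega> = moment i \<Omega>') \<and> moment f \<Omega> \<noteq> moment f \<Omega>'"
    using F(3) by (auto simp: vanishing_orders_def)
  then obtain \<Omega> \<Omega>' where \<Omega>: "\<And>f. f \<in> F \<Longrightarrow> \<Omega> f \<subseteq> {..B}" "\<And>f. f \<in> F \<Longrightarrow> \<Omega>' f \<subseteq> {..B}"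
    "\<And>f i. f \<in> F \<Longrightarrow> i < f \<Longrightarrow> moment i (\<Omega> f) = moment i (\<Omega>' f)"
    "\<And>f. f \<in> F \<Longrightarrow> moment f (\<Omega> f) \<noteq> moment f (\<Omega>' f)"
    by metis
  have fin\<Omega>: "finite (\<Omega> f)" "finite (\<Omega>' f)" if "f \<in> F" for f
    using \<Omega>(1,2)[OF that] finite_subset by blast+
  have "real (2 * p) > 0" using p q by simp
  from eventually_exp_diff_lacunary[of F \<Omega> \<Omega>', OF F(1) sp fin\<Omega> \<Omega>(3,4) this]
  obtain d0 where d0: "d0 > 0" "\<And>d f. 0 < d \<Longrightarrow> d < d0 \<Longrightarrow> f \<in> F \<Longrightarrow> exp_diff (\<Omega> f) (\<Omega>' f) d \<noteq> 0"
    "\<And>d f g. 0 < d \<Longrightarrow> d < d0 \<Longrightarrow> f \<in> F \<Longrightarrow> g \<in> F \<Longrightarrow> f < g \<Longrightarrow>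
      real (2 * p) * \<bar>exp_diff (\<Omega> g) (\<Omega>' g) d\<bar> \<le> \<bar>exp_diff (\<Omega> f) (\<Omega>' f) d\<bar> * d"
    unfolding eventually_at_right_field by blast
  \<comment> \<open>The last condition will push \<open>d\<close> below \<open>d0\<close>; the bound
    on \<open>p\<close> pays for the denominator in the binomial estimate.\<close>
  have large: "\<forall>\<^sub>F n::real in at_top. 1 < n \<and> 2 \<le> n powr \<epsilon> \<and> real p \<le> n powr (1/8) \<and>
      2 + 1 / d0 \<le> n powr (3/8)"
    using \<epsilon> by (intro eventually_conj eventually_powr_ge eventually_gt_at_top) auto
  have main: "n powr q \<le> card (hfold_sumset h A)"
    if n: "1 < n" "2 \<le> n powr \<epsilon>" "real p \<le> n powr (1/8)" "2 + 1 / d0 \<le> n powr (3/8)"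
      and A: "finite A" "A \<subseteq> {0<..}" and cA: "n powr (1 - \<epsilon>) \<le> card A"
      and cAA: "card (A * A) \<le> n powr (1 + \<epsilon>)" for n :: real and A :: "real set"
  proof (rule ccontr)
    assume "\<not> ?thesis"
    then have hA: "card (hfold_sumset h A) < n powr q" by simp
    have "A \<noteq> {}" using cA n by (auto simp: powr_gt_zero)
    have le_q: "card (hfold_sumset j A') < n powr q" if "j \<le> h" "A' \<subseteq> A" for j A'
    proof -
      have "card (hfold_sumset j A') \<le> card (hfold_sumset j A)"
        using A that by (intro card_mono hfold_sumset_mono) auto
      also have "\<dots> \<le> card (hfold_sumset h A)"
        using A \<open>A \<noteq> {}\<close> that by (intro card_hfold_sumset_mono)
      finally show ?thesis using hA by simp
    qed
    have Jh: "J \<le> h" using h by (simp add: algebra_simps)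
    have "card (hfold_sumset j A) \<le> n powr q" if "j \<le> J" for j
      using le_q[of j A] Jh that by simp
    from ex_stable_subset[OF A(1) n(1) C \<epsilon> cA this M \<delta>]
    obtain A' \<alpha> where A': "A' \<subseteq> A" "\<epsilon> \<le> \<alpha>" "\<alpha> \<le> C ^ M * \<epsilon>" "n powr (1 - \<alpha>) \<le> card A'"
      and stable: "\<And>A'' j. A'' \<subseteq> A' \<Longrightarrow> n powr (1 - C * \<alpha>) \<le> card A'' \<Longrightarrow> j \<le> J \<Longrightarrow>
        card (hfold_sumset j A') \<le> n powr \<delta> * card (hfold_sumset j A'')"
      by metis
    have finA': "finite A'" using A' A finite_subset by blast
    have posA': "A' \<subseteq> {0<..}" using A' A by blast
    have "A' \<noteq> {}" using A'(4) n by (auto simp: powr_gt_zero)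
    have "2 \<le> n powr \<alpha>" using n(2) powr_mono[OF A'(2), of n] n(1) by linarith
    moreover have "card (A' * A') \<le> n powr (1 + \<alpha>)"
    proof -
      have "card (A' * A') \<le> card (A * A)"
        by (rule card_mono[OF finite_set_times[OF A(1) A(1)] set_times_mono2[OF A'(1) A'(1)]])
      also have "\<dots> \<le> n powr (1 + \<epsilon>)" by (rule cAA)
      also have "\<dots> \<le> n powr (1 + \<alpha>)" using A' n by (intro powr_mono) auto
      finally show ?thesis by simp
    qed
    moreover have "C * \<alpha> \<le> 1 / 8"
    proof -
      have "C * \<alpha> \<le> C * (C ^ M * \<epsilon>)" using A' C by (intro mult_left_mono) auto
      also have "\<dots> = 1 / 8" using C by (simp add: \<epsilon>_def)
      finally show ?thesis .
    qed
    ultimately obtain d S where d: "d > 0"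
      and pop: "\<And>b. b \<le> B \<Longrightarrow> n powr (1 - C * \<alpha>) \<le> card (A' \<inter> (*) (exp (real b * d)) ` A')"
      and S: "S \<subseteq> ln ` A'" "\<forall>s\<in>S. \<forall>s'\<in>S. s < s' \<longrightarrow> s + d \<le> s'" "n powr (7/8) \<le> card S"
      using ex_popular_dilates[OF finA' posA' n(1) _ _ A'(4), of B] A'(2) \<epsilon> unfolding C_def by auto
    have finS: "finite S" using S finA' finite_subset by blast
    have expS: "exp ` X \<subseteq> A'" "inj_on exp X" if "X \<subseteq> S" for X
      using that S posA' by (fastforce simp: inj_on_def)+
    show False
    \<comment> \<open>A window of length \<open>ln 2\<close> in the logarithms is one dyadic scale
      of \<open>A'\<close>.\<close>
    proof (cases "\<exists>x. n powr (3/8) < card (S \<inter> {x..<x + ln 2})")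
      case True
      then obtain x where x: "n powr (3/8) < card (S \<inter> {x..<x + ln 2})" by blast
      define T where "T = S \<inter> {x..<x + ln 2}"
      have T: "finite T" "T \<noteq> {}" "T \<subseteq> S" using x finS by (auto simp: T_def)
      \<comment> \<open>More than \<open>1 + 1 / d0\<close> gaps of size at least \<open>d\<close>
        fit into length \<open>ln 2 \<le> 1\<close>, so \<open>d < d0\<close>.\<close>
      have "(real (card T) - 1) * d \<le> Max T - Min T"
        using S T by (intro separated_card_le) auto
      also have "Max T \<in> T" "Min T \<in> T" using T by auto
      then have "Max T - Min T \<le> ln 2" by (auto simp: T_def)
      also have "ln 2 \<le> (1::real)" using ln_le_minus_one[of "2::real"] by simp
      finally have "(real (card T) - 1) * d \<le> 1" by simp
      moreover have "1 / d0 * d < (real (card T) - 1) * d"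
        using n x d by (intro mult_strict_right_mono) (auto simp: T_def)
      ultimately have "1 / d0 * d < 1" by linarith
      then have dd0: "d < d0" using d0(1) by (simp add: field_simps)
      have "inj_on (\<lambda>s. \<Sum>f\<in>F. exp_diff (\<Omega> f) (\<Omega>' f) d * s f) (PiE F (\<lambda>_. exp ` T))"
      proof (rule inj_on_weighted_sum[OF F(1) _ exp_gt_zero[of x] d])
        show "exp ` T \<subseteq> {exp x..2 * exp x}"
        proof safe
          fix t assume t: "t \<in> T"
          then have "exp t \<le> exp (x + ln 2)" by (simp add: T_def)
          also have "\<dots> = 2 * exp x" by (simp add: exp_add)
          finally show "exp t \<in> {exp x..2 * exp x}" using t by (simp add: T_def)
        qed
        fix s s' assume "s \<in> exp ` T" "s' \<in> exp ` T" "s < s'"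
        then obtain t t' where t: "t \<in> T" "t' \<in> T" "t < t'" "s = exp t" "s' = exp t'" by auto
        have "d * exp x \<le> d * exp t" using t d by (simp add: T_def)
        then have "s + d * exp x \<le> (1 + d) * exp t" using t by (simp add: algebra_simps)
        also have "\<dots> \<le> exp d * exp t" by (intro mult_right_mono exp_ge_add_one_self) auto
        also have "\<dots> = exp (t + d)" by (simp add: exp_add)
        also have "\<dots> \<le> s'" using t S T by auto
        finally show "s + d * exp x \<le> s'" .
      qed (use d0 d dd0 F in auto)
      from card_power_le_card_sum_dilates[OF F(1) fin\<Omega> finA' expS(1)[OF T(3)] this]
      have low: "card (exp ` T) ^ p \<le>
          card (\<Sum>i\<in>Sigma F \<Omega>. (*) (exp (real (snd i) * d)) ` A') *
          card (\<Sum>i\<in>Sigma F \<Omega>'. (*) (exp (real (snd i) * d)) ` A')" by (simp add: F)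
      have "card (hfold_sumset J A') \<le> n powr q" using le_q[OF Jh A'(1)] by simp
      also have "n powr q = (n powr (real q / real J)) ^ J" using J0 n by (simp add: powr_power)
      finally obtain j where j: "j < J"
        "real (card (hfold_sumset (Suc j) A')) \<le> n powr (real q / real J) * card (hfold_sumset j A')"
        using ex_slow_growth[OF \<open>A' \<noteq> {}\<close> _ _ J0] by (metis powr_ge_zero)
      \<comment> \<open>Stated for any family, as it is applied to both \<open>\<Omega>\<close> and
        \<open>\<Omega>'\<close>. There are at most \<open>r\<close> dilates, and each costs
        \<open>n powr (q / J + \<delta>) = n powr (1 / r)\<close>, hence a factor \<open>n\<close>
        in total.\<close>
      have up: "real (card (\<Sum>i\<in>Sigma F \<Omega>. (*) (exp (real (snd i) * d)) ` A')) \<le> n powr (1 + real q)"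
        if \<Omega>: "\<And>f. f \<in> F \<Longrightarrow> \<Omega> f \<subseteq> {..B}" for \<Omega>
      proof -
        have fin: "finite (\<Omega> f)" if "f \<in> F" for f using \<Omega>[OF that] finite_subset by blast
        have "card (Sigma F \<Omega>) = (\<Sum>f\<in>F. card (\<Omega> f))" using F fin by simp
        also have "\<dots> \<le> (\<Sum>f\<in>F. B + 1)"
          using card_mono[OF _ \<Omega>] by (intro sum_mono) auto
        finally have cI: "card (Sigma F \<Omega>) \<le> r" by (simp add: r F)
        have "real (card (\<Sum>i\<in>Sigma F \<Omega>. (*) (exp (real (snd i) * d)) ` A'))
            \<le> (n powr (real q / real J) * n powr \<delta>) ^ card (Sigma F \<Omega>) * card (hfold_sumset (card {..B} * j) A')"
        proof (rule card_sum_dilates_le_hfold_sumset[OF finA' \<open>A' \<noteq> {}\<close> _ _ _ _ _ j(2)])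
          show "card (hfold_sumset j A') \<le>
              n powr \<delta> * card (hfold_sumset j (A' \<inter> (*) (exp (real b * d)) ` A'))" if "b \<in> {..B}" for b
            using that j pop by (intro stable) auto
          show "finite (Sigma F \<Omega>)" using F fin by auto
          show "snd ` Sigma F \<Omega> \<subseteq> {..B}" using \<Omega> by force
        qed auto
        also have "n powr (real q / real J) * n powr \<delta> = n powr (1 / real r)"
        proof -
          have "real q / real J + \<delta> = 1 / real r" using r0 q by (simp add: J \<delta>_def field_simps)
          then show ?thesis by (simp flip: powr_add)
        qed
        also have "(n powr (1 / real r)) ^ card (Sigma F \<Omega>) \<le> (n powr (1 / real r)) ^ r"
          using cI n by (intro power_increasing ge_one_powr_ge_zero) auto
        also have "\<dots> = n" using n r0 by (simp add: powr_power)
        also have "n * card (hfold_sumset (card {..B} * j) A') \<le> n * n powr q"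
        proof -
          have "card {..B} * j \<le> (B + 1) * J" using j by (intro mult_mono) auto
          then have "card {..B} * j \<le> h" using h by linarith
          from le_q[OF this A'(1)] show ?thesis using n by simp
        qed
        also have "\<dots> = n powr (1 + real q)" using n by (simp add: powr_add)
        finally show ?thesis by (simp add: mult_right_mono)
      qed
      \<comment> \<open>The choice \<open>p = 16 * q\<close> makes the lower bound
        \<open>n powr (6 * q)\<close>, against the upper bound \<open>n powr (2 + 2 * q)\<close>;
        these conflict for \<open>q \<ge> 1\<close>.\<close>
      have "n powr (6 * real q) = (n powr (3/8)) ^ p" using n by (simp add: p powr_power)
      also have "\<dots> \<le> real (card (exp ` T)) ^ p"
        using x expS(2)[OF T(3)] by (intro power_mono) (auto simp: T_def card_image)
      also have "\<dots> \<le> real (card (\<Sum>i\<in>Sigma F \<Omega>. (*) (exp (real (snd i) * d)) ` A')) *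
          real (card (\<Sum>i\<in>Sigma F \<Omega>'. (*) (exp (real (snd i) * d)) ` A'))"
        using of_nat_mono[OF low, where 'a = real] by simp
      also have "\<dots> \<le> n powr (1 + real q) * n powr (1 + real q)"
        by (intro mult_mono up \<Omega>) auto
      also have "\<dots> = n powr ((1 + real q) + (1 + real q))" by (simp only: powr_add)
      finally have "6 * real q \<le> (1 + real q) + (1 + real q)"
        using n(1) by (simp only: powr_le_cancel_iff)
      then show False using q by simp
    next
      case False
      then have "real (card (S \<inter> {x..<x + ln 2})) \<le> n powr (3/8)" for x by (meson not_less)
      \<comment> \<open>No dyadic scale is crowded, so at least \<open>n powr (3/8)\<close> points
        remain after thinning to gaps \<open>ln 2\<close>; their exponentials are lacunary.\<close>
      from ex_separated_subset[OF finS this] obtain T where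
        T: "T \<subseteq> S" "\<forall>s\<in>T. \<forall>s'\<in>T. s < s' \<longrightarrow> s + ln 2 \<le> s'" "real (card S) \<le> n powr (3/8) * card T"
        by auto
      have "n powr (3/8) * n powr (3/8) \<le> n powr (7/8)"
        using n by (simp flip: powr_add)
      also have "\<dots> \<le> n powr (3/8) * card T" using S T by simp
      finally have cT: "n powr (3/8) \<le> card T" using n by simp
      have "n powr (1/8) \<le> n powr (3/8)" using n by (intro powr_mono) auto
      with cT n have pT: "p \<le> card T" by linarith
      have "card (exp ` T) choose p \<le> card (hfold_sumset p A')"
      proof (rule card_hfold_sumset_lacunary[OF finA' expS(1)[OF T(1)]])
        fix s s' assume "s \<in> exp ` T" "s' \<in> exp ` T" "s < s'"
        then obtain t t' where t: "t \<in> T" "t' \<in> T" "t < t'" "s = exp t" "s' = exp t'" by auto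
        have "2 * s = exp (t + ln 2)" using t by (simp add: exp_add)
        also have "\<dots> \<le> s'" using t T by auto
        finally show "2 * s \<le> s'" .
      qed auto
      then have le: "card T choose p \<le> card (hfold_sumset p A')"
        using expS(2)[OF T(1)] by (simp add: card_image)
      have "p * 1 \<le> r * (2 * q)" using q unfolding r by (intro mult_mono) auto
      then have "p \<le> J" by (simp add: J mult_ac)
      then have "p \<le> h" using Jh by simp
      have p0: "p > 0" using p q by simp
      have "n powr (4 * real q) = (n powr (1/4)) ^ p" using n by (simp add: p powr_power)
      also have "\<dots> \<le> (real (card T) / real p) ^ p"
      proof (rule power_mono)
        have "n powr (1/4) * real p \<le> n powr (1/4) * n powr (1/8)"
          using n by (intro mult_left_mono) auto
        also have "\<dots> = n powr (3/8)" by (simp flip: powr_add)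
        finally show "n powr (1/4) \<le> real (card T) / real p" using cT p0 by (simp add: field_simps)
      qed simp
      also have "\<dots> \<le> real (card T choose p)" by (rule binomial_ge_n_over_k_pow_k[OF pT])
      also have "\<dots> \<le> card (hfold_sumset p A')" using le by simp
      also have "\<dots> < n powr q" by (rule le_q[OF \<open>p \<le> h\<close> A'(1)])
      finally show False using n by simp
    qed
  qed
  have "\<forall>\<^sub>F n in at_top. \<forall>A::real set. finite A \<and> A \<subseteq> {0<..} \<and>
     n powr (1 - \<epsilon>) \<le> real (card A) \<and> real (card (A * A)) \<le> n powr (1 + \<epsilon>) \<longrightarrow>
     n powr q \<le> card (hfold_sumset h A)"
    using large
  proof (rule eventually_mono, intro allI impI, elim conjE)
    fix n :: real and A :: "real set"
    assume "1 < n" "2 \<le> n powr \<epsilon>" "real p \<le> n powr (1/8)" "2 + 1 / d0 \<le> n powr (3/8)"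
      "finite A" "A \<subseteq> {0<..}" "n powr (1 - \<epsilon>) \<le> card A" "card (A * A) \<le> n powr (1 + \<epsilon>)"
    then show "n powr q \<le> card (hfold_sumset h A)" by (rule main)
  qed
  then show ?thesis using \<epsilon> by blast
qed

section \<open>Few products force many sums\<close>

lemma card_hfold_sumset_uminus:
  fixes A :: "real set"
  shows "card (hfold_sumset h (uminus ` A)) = card (hfold_sumset h A)"
proof -
  have "uminus ` A = (*) (-1) ` A" by (intro image_cong) auto
  then show ?thesis
    by (simp only: hfold_sumset_image_mult) (simp add: card_image inj_on_def)
qed

text \<open>Keep the larger of the positive part and the reflected negative part: reflection
  preserves the sizes of product set and sumset. The \<open>+ 1\<close> accounts for zero.\<close>

lemma ex_positive_part:
  fixes A :: "real set"
  assumes A: "finite A" "A \<noteq> {}"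
  shows "\<exists>A0::real set. finite A0 \<and> A0 \<subseteq> {0<..} \<and> card A \<le> 2 * card A0 + 1 \<and>
    card (A0 * A0) \<le> card (A * A) \<and> card (hfold_sumset h A0) \<le> card (hfold_sumset h A)"
proof -
  define P where "P = {a\<in>A. 0 < a}"
  define N where "N = {a\<in>A. a < 0}"
  have fin: "finite P" "finite N" using A by (auto simp: P_def N_def)
  have "A \<subseteq> insert 0 (P \<union> N)" by (auto simp: P_def N_def)
  then have "card A \<le> card (insert 0 (P \<union> N))" using fin by (intro card_mono) auto
  also have "\<dots> \<le> Suc (card (P \<union> N))" by (rule card_insert_le_m1) auto
  also have "card (P \<union> N) \<le> card P + card N" by (rule card_Un_le)
  finally have c: "card A \<le> card P + card N + 1" by simp
  have prod: "card (X * X) \<le> card (A * A)" if "X \<subseteq> A" for X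
    using A(1) that by (intro card_mono finite_set_times set_times_mono2)
  have sums: "card (hfold_sumset h X) \<le> card (hfold_sumset h A)" if "X \<subseteq> A" for X
    using A(1) that by (intro card_mono hfold_sumset_mono) auto
  have PN: "P \<subseteq> A" "N \<subseteq> A" by (auto simp: P_def N_def)
  show ?thesis
  proof (cases "card N \<le> card P")
    case True
    then show ?thesis using c fin prod[OF PN(1)] sums[OF PN(1)]
      by (intro exI[of _ P]) (auto simp: P_def)
  next
    case False
    have "uminus ` N * uminus ` N = N * N"
      by (force simp: set_times_def image_iff)
    then show ?thesis using False c fin prod[OF PN(2)] sums[OF PN(2)]
      by (intro exI[of _ "uminus ` N"])
        (auto simp: N_def card_hfold_sumset_uminus card_image inj_on_def)
  qed
qed

text \<open>With \<open>q = 2 ^ s\<close>, the \<open>p = 2 ^ (s + 4)\<close> orders require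
  \<open>B = 2 ^ (4 * (s + 4) + 26)\<close>. Then
  \<open>(B + 1) * J = 2 * p * q * (B + 1)\<^sup>2\<close> stays below
  \<open>2 ^ (10 * s + 91)\<close>.\<close>

lemma card_hfold_sumset_ge_powr:
  fixes s h :: nat
  assumes h: "2 ^ (10 * s + 91) \<le> h"
  shows "\<exists>\<epsilon>>0. \<exists>n0. \<forall>A::real set. finite A \<and> n0 \<le> card A \<and>
    real (card (A * A)) \<le> real (card A) powr (1 + \<epsilon>) \<longrightarrow>
    real (card A) powr (2 ^ s) \<le> card (hfold_sumset h A)"
proof -
  define q p B r J :: nat where "q = 2 ^ s" and "p = 16 * q" and "B = 2 ^ (4 * s + 42)"
    and "r = p * (B + 1)" and "J = 2 * r * q"
  have p: "p = 2 ^ (s + 4)" by (simp add: p_def q_def power_add)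
  have B: "B = 2 ^ (4 * (s + 4) + 26)" by (simp add: B_def)
  obtain F where F: "finite F" "card F = p" "F \<subseteq> vanishing_orders B"
    "\<And>f g. f \<in> F \<Longrightarrow> g \<in> F \<Longrightarrow> f < g \<Longrightarrow> f + 2 \<le> g"
    using many_vanishing_orders[of "s + 4"] unfolding p B by blast
  have "(B + 1) * J = 2 * p * q * (B + 1)\<^sup>2"
    by (simp add: J_def r_def power2_eq_square algebra_simps)
  also have "\<dots> \<le> 2 * p * q * (2 * B)\<^sup>2"
    by (intro mult_left_mono power_mono) (auto simp: B_def)
  also have "\<dots> = 2 ^ 1 * 2 ^ (s + 4) * 2 ^ s * (2 ^ (4 * s + 43))\<^sup>2"
  proof -
    have "(2::nat) ^ (4 * s + 43) = 2 * B" unfolding B_def by (simp flip: power_Suc)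
    then show ?thesis by (simp add: p q_def)
  qed
  also have "\<dots> = 2 ^ (1 + (s + 4) + s + (4 * s + 43) * 2)"
    by (simp only: power_add power_mult)
  also have "\<dots> \<le> 2 ^ (10 * s + 91)" by (intro power_increasing) auto
  also have "\<dots> \<le> h" by (rule h)
  finally have "(B + 1) * J \<le> h" .
  from card_hfold_sumset_positive[OF F _ p_def r_def J_def this]
  obtain \<epsilon> where \<epsilon>: "\<epsilon> > 0" "\<forall>\<^sub>F n in at_top. \<forall>A::real set. finite A \<and> A \<subseteq> {0<..} \<and>
     n powr (1 - \<epsilon>) \<le> real (card A) \<and> real (card (A * A)) \<le> n powr (1 + \<epsilon>) \<longrightarrow>
     n powr q \<le> card (hfold_sumset h A)"
    by (auto simp: q_def)
  \<comment> \<open>The positive part has at least \<open>(n - 1) / 2 \<ge> n / 3\<close> elements,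
    and \<open>3 \<le> n powr \<epsilon>\<close> turns this into the density
    \<open>n powr (1 - \<epsilon>)\<close>.\<close>
  have "\<forall>\<^sub>F n::real in at_top. 3 \<le> n powr \<epsilon> \<and> 3 \<le> n \<and> (\<forall>A::real set. finite A \<and> A \<subseteq> {0<..} \<and>
     n powr (1 - \<epsilon>) \<le> real (card A) \<and> real (card (A * A)) \<le> n powr (1 + \<epsilon>) \<longrightarrow>
     n powr q \<le> card (hfold_sumset h A))"
    by (intro eventually_conj \<epsilon>(2) eventually_powr_ge \<epsilon>(1) eventually_ge_at_top)
  then obtain N where N: "\<And>n::real. n \<ge> N \<Longrightarrow> 3 \<le> n powr \<epsilon> \<and> 3 \<le> n \<and> (\<forall>A::real set. finite A \<and> A \<subseteq> {0<..} \<and>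
     n powr (1 - \<epsilon>) \<le> real (card A) \<and> real (card (A * A)) \<le> n powr (1 + \<epsilon>) \<longrightarrow>
     n powr q \<le> card (hfold_sumset h A))"
    unfolding eventually_at_top_linorder by blast
  have "real (card A) powr (2 ^ s) \<le> card (hfold_sumset h A)"
    if A: "finite A" "nat \<lceil>N\<rceil> \<le> card A" "real (card (A * A)) \<le> real (card A) powr (1 + \<epsilon>)"
    for A :: "real set"
  proof -
    define n where "n = real (card A)"
    have "N \<le> n" using A(2) by (simp add: n_def nat_le_iff ceiling_le_iff)
    from N[OF this] have n: "3 \<le> n powr \<epsilon>" "3 \<le> n" and
      *: "\<And>A::real set. finite A \<Longrightarrow> A \<subseteq> {0<..} \<Longrightarrow> n powr (1 - \<epsilon>) \<le> real (card A) \<Longrightarrow>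
        real (card (A * A)) \<le> n powr (1 + \<epsilon>) \<Longrightarrow> n powr q \<le> card (hfold_sumset h A)"
      by auto
    have "A \<noteq> {}" using n by (auto simp: n_def)
    from ex_positive_part[OF A(1) this, of h] obtain A0 :: "real set" where
      A0: "finite A0" "A0 \<subseteq> {0<..}" "card A \<le> 2 * card A0 + 1"
      "card (A0 * A0) \<le> card (A * A)" "card (hfold_sumset h A0) \<le> card (hfold_sumset h A)"
      by blast
    have "n powr (1 - \<epsilon>) = n / n powr \<epsilon>" using n by (simp add: powr_diff)
    also have "\<dots> \<le> n / 3" using n by (intro divide_left_mono) auto
    also have "\<dots> \<le> card A0" using A0(3) n by (simp add: n_def)
    finally have "n powr q \<le> card (hfold_sumset h A0)"
      using A0 A(3) by (intro *) (auto simp: n_def)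
    also have "\<dots> \<le> card (hfold_sumset h A)" using A0 by simp
    finally show ?thesis by (simp add: n_def q_def)
  qed
  then show ?thesis using \<epsilon>(1) by blast
qed

text \<open>The crude linear bound \<open>sqrt x \<le> x + 1 / 4\<close> suffices: a tenth of
  \<open>ln h\<close> is already at most about \<open>s * ln 2\<close>, and the step from 10.1 to 11
  absorbs the remaining \<open>1 / 40\<close>.\<close>

lemma exp_sqrt_ln_le:
  fixes h s :: nat
  assumes "h \<ge> 1" "h < 2 ^ (10 * s + 101)"
  shows "exp (sqrt (1 / 100 * ln (real h))) \<le> 2 ^ (s + 11)"
proof -
  define x where "x = ln (real h)"
  have x0: "x \<ge> 0" using assms by (simp add: x_def)
  have "real h \<le> 2 ^ (10 * s + 101)" using assms(2) by (metis less_imp_le of_nat_le_iff of_nat_numeral of_nat_power)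
  then have "x \<le> ln (2 ^ (10 * s + 101))" using assms by (simp add: x_def)
  also have "\<dots> = (10 * real s + 101) * ln 2" by (simp add: ln_realpow)
  finally have x: "x \<le> (10 * real s + 101) * ln 2" .
  have "sqrt (1 / 100 * x) = sqrt x / 10" by (simp add: real_sqrt_divide)
  also have "\<dots> \<le> x / 10 + 1 / 40"
  proof -
    have "0 \<le> (sqrt x - 1 / 2)\<^sup>2" by simp
    also have "\<dots> = x - sqrt x + 1 / 4" using x0 by (simp add: power2_diff power_divide)
    finally show ?thesis by simp
  qed
  also have "\<dots> \<le> (real s + 11) * ln 2" using x ln2_ge_two_thirds by (simp add: algebra_simps)
  finally have "exp (sqrt (1 / 100 * x)) \<le> exp ((real s + 11) * ln 2)" by simp
  also have "\<dots> = 2 ^ (s + 11)"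
    using powr_realpow[of 2 "s + 11"] by (simp add: powr_def)
  finally show ?thesis by (simp add: x_def)
qed

theorem theorem1:
  shows "\<exists>c::real. c > 0 \<and>
    (\<forall>h::nat. h \<ge> 1 \<longrightarrow>
      (\<exists>\<epsilon>::real. \<epsilon> > 0 \<and>
        (\<exists>n0::nat. \<forall>A::real set.
          finite A \<and> card A \<ge> n0 \<and>
          real (card (A * A)) \<le> real (card A) powr (1 + \<epsilon>) \<longrightarrow>
          real (card (hfold_sumset h A))
            \<ge> real (card A) powr (c * exp (sqrt (1 / 100 * ln (real h)))))))"
\<comment> \<open>This constant cancels the surplus in the bound
  \<open>2 ^ (s + 11)\<close>.\<close>
proof (rule exI[of _ "1 / 2 ^ 11"], intro conjI allI impI)
  fix h :: nat assume h: "h \<ge> 1"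
  define e where "e = 1 / 2 ^ 11 * exp (sqrt (1 / 100 * ln (real h)))"
  have e_le: "e \<le> 2 ^ s" if "h < 2 ^ (10 * s + 101)" for s
    using exp_sqrt_ln_le[OF h that] by (simp add: e_def power_add)
  have "\<exists>\<epsilon>>0. \<exists>n0. \<forall>A::real set. finite A \<and> n0 \<le> card A \<and>
      real (card (A * A)) \<le> real (card A) powr (1 + \<epsilon>) \<longrightarrow>
      real (card A) powr e \<le> card (hfold_sumset h A)"
  proof (cases "h < 2 ^ 101")
    case True
    \<comment> \<open>For small \<open>h\<close> the case \<open>s = 0\<close> gives
      \<open>e \<le> 1\<close>, and \<open>hA\<close> is at least as large as
      \<open>A\<close>.\<close>
    have "real (card A) powr e \<le> card (hfold_sumset h A)" if "finite A" "1 \<le> card A" for A :: "real set"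
    proof -
      have "A \<noteq> {}" using that by auto
      have "real (card A) powr e \<le> real (card A) powr 1"
        using e_le[of 0] True that by (intro powr_mono) auto
      also have "\<dots> = card (hfold_sumset 1 A)"
        using that by (simp add: hfold_sumset_Suc flip: set_zero)
      also have "\<dots> \<le> card (hfold_sumset h A)"
        using that h \<open>A \<noteq> {}\<close> by (intro of_nat_mono card_hfold_sumset_mono)
      finally show ?thesis .
    qed
    then show ?thesis by (intro exI[of _ 1] conjI) auto
  next
    case False
    define P where "P s \<longleftrightarrow> 2 ^ (10 * s + 91) \<le> h" for s :: nat
    have bound: "s \<le> h" if "P s" for s
    proof -
      have "s < 2 ^ s" by simp
      also have "(2::nat) ^ s \<le> 2 ^ (10 * s + 91)" by (intro power_increasing) auto
      also have "\<dots> \<le> h" using that by (simp add: P_def)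
      finally show ?thesis by simp
    qed
    \<comment> \<open>Maximality of \<open>s\<close> gives the upper bound on \<open>h\<close>: the
      next threshold has exponent \<open>10 * Suc s + 91 = 10 * s + 101\<close>.\<close>
    define s where "s = Greatest P"
    have "P 1" using False by (simp add: P_def)
    then have "P s" unfolding s_def using bound by (intro GreatestI_nat[of P 1 h]) auto
    have "\<not> P (Suc s)" using Greatest_le_nat[of P "Suc s" h] bound by (auto simp: s_def)
    then have "h < 2 ^ (10 * s + 101)" by (simp add: P_def not_le add.commute)
    then have e: "e \<le> 2 ^ s" by (rule e_le)
    obtain \<epsilon> n0 where \<epsilon>: "\<epsilon> > 0" and n0: "\<And>A::real set. finite A \<Longrightarrow> n0 \<le> card A \<Longrightarrow>
      real (card (A * A)) \<le> real (card A) powr (1 + \<epsilon>) \<Longrightarrow>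
      real (card A) powr (2 ^ s) \<le> card (hfold_sumset h A)"
      using card_hfold_sumset_ge_powr[of s h] \<open>P s\<close> unfolding P_def by blast
    have "real (card A) powr e \<le> card (hfold_sumset h A)"
      \<comment> \<open>The maximum with 1 excludes the empty set, so the power is monotone in its
        exponent.\<close>
      if A: "finite A" "max 1 n0 \<le> card A" "real (card (A * A)) \<le> real (card A) powr (1 + \<epsilon>)"
      for A :: "real set"
    proof -
      have "real (card A) powr e \<le> real (card A) powr (2 ^ s)"
        using e A by (intro powr_mono) auto
      also have "\<dots> \<le> card (hfold_sumset h A)" using A by (intro n0) auto
      finally show ?thesis .
    qed
    then show ?thesis using \<epsilon> by blast
  qed
  then show "\<exists>\<epsilon>>0. \<exists>n0. \<forall>A::real set. finite A \<and> n0 \<le> card A \<and>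
      real (card (A * A)) \<le> real (card A) powr (1 + \<epsilon>) \<longrightarrow>
      real (card A) powr (1 / 2 ^ 11 * exp (sqrt (1 / 100 * ln (real h)))) \<le> card (hfold_sumset h A)"
    unfolding e_def .
qed simp

end
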